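(* For any holomorphic function $f: V\to \mathbb{C}$ with $\int_{V} |f|^{2/m}\exp (-\varphi)\frac{d\lambda_V}{|\partial h|^2}\leq 1$, there exists $F\in \mathcal{O}(\Omega)$ such that (i) $F_{|V}= f$, and (ii) $\int_{\Omega} |F|^{2/m}\exp (-\varphi)d\lambda \leq C_0\int_{V} |f|^{2/m}\exp (-\varphi)\frac{d\lambda_V}{|\partial h|^2}$, where $C_0$ is the same absolute constant as in the Ohsawa–Takegoshi extension theorem.
   Context: Let $\Omega\subset \mathbb{C}^n$ be a ball of radius $r$, $h:\Omega\to\mathbb{C}$ holomorphic with $\sup_\Omega |h|\le 1$ and $\partial h$ nowhere zero on $V:=(h=0)$. Let $\varphi$ be plurisubharmonic on $\Omega$ with $\varphi_{|V}\not\equiv-\infty$. Let $m\geq 1$ be an integer. The Ohsawa–Takegoshi theorem states that any holomorphic $f$ on $V$ admits a holomorphic extension $F$ to $\Omega$ with $\int_\Omega |F|^2 e^{-\varphi}d\lambda\le C_0\int_V |f|^2 e^{-\varphi}\frac{d\lambda_V}{|\partial h|^2}$, with $C_0$ an absolute constant. *)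

theory Defs
  imports "HOL-Analysis.Analysis"
begin

definition holo_n :: "(complex^'n \<Rightarrow> complex) \<Rightarrow> (complex^'n) set \<Rightarrow> bool" where
  "holo_n F U \<longleftrightarrow> open U \<and> (\<forall>z\<in>U. \<exists>L. (F has_derivative L) (at z) \<and>
      (\<forall>c v. L (c *s v) = c * L v))"

definition cpartial :: "(complex^'n \<Rightarrow> complex) \<Rightarrow> 'n \<Rightarrow> complex^'n \<Rightarrow> complex" where
  "cpartial h j z = frechet_derivative h (at z) (axis j 1)"

definition dh_norm_sq :: "(complex^'n \<Rightarrow> complex) \<Rightarrow> complex^'n \<Rightarrow> real" where
  "dh_norm_sq h z = (\<Sum>j\<in>UNIV. (cmod (cpartial h j z))^2)"

definition holo_on_subvariety :: "(complex^'n \<Rightarrow> complex) \<Rightarrow> (complex^'n) set \<Rightarrow> bool" where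
  "holo_on_subvariety f V \<longleftrightarrow> (\<forall>p\<in>V. \<exists>U G. open U \<and> p \<in> U \<and> holo_n G U \<and>
      (\<forall>z\<in>U \<inter> V. G z = f z))"

text \<open>Mean value of an (extended-real, bounded above) function over the circle
  {a + e^{i t} b : t \<in> [0, 2\<pi>]}; the integral of u is the integral of its positive
  part minus the integral of its negative part.\<close>
definition circle_mean :: "(complex^'n \<Rightarrow> ereal) \<Rightarrow> complex^'n \<Rightarrow> complex^'n \<Rightarrow> ereal" where
  "circle_mean u a b =
     (enn2ereal (\<integral>\<^sup>+ t\<in>{0..2*pi}. e2ennreal (u (a + cis t *s b)) \<partial>lborel)
      - enn2ereal (\<integral>\<^sup>+ t\<in>{0..2*pi}. e2ennreal (- u (a + cis t *s b)) \<partial>lborel))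
     / ereal (2 * pi)"

definition psh_on :: "(complex^'n) set \<Rightarrow> (complex^'n \<Rightarrow> ereal) \<Rightarrow> bool" where
  "psh_on U \<phi> \<longleftrightarrow> open U \<and> (\<forall>z\<in>U. \<phi> z \<noteq> \<infinity>) \<and>
     (\<forall>c::ereal. openin (top_of_set U) {z\<in>U. \<phi> z < c}) \<and>
     (\<forall>a b. (\<forall>\<zeta>::complex. cmod \<zeta> \<le> 1 \<longrightarrow> a + \<zeta> *s b \<in> U) \<longrightarrow>
        \<phi> a \<le> circle_mean \<phi> a b)"

definition exp_neg :: "ereal \<Rightarrow> ennreal" where
  "exp_neg x = (case x of ereal r \<Rightarrow> ennreal (exp (- r)) | PInfty \<Rightarrow> 0 | MInfty \<Rightarrow> \<infinity>)"

text \<open>k-dimensional Hausdorff measure (normalized so that it agrees with Lebesgue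
  measure on k-planes), used for the surface measure d\<lambda>_V (k = 2n-2).\<close>
definition hausdorff_pre :: "nat \<Rightarrow> real \<Rightarrow> 'a::metric_space set \<Rightarrow> ennreal" where
  "hausdorff_pre k \<delta> A =
     (INF C \<in> {C :: nat \<Rightarrow> 'a set. A \<subseteq> (\<Union>i. C i) \<and> (\<forall>i. bounded (C i) \<and> diameter (C i) \<le> \<delta>)}.
        (\<Sum>i. ennreal (if C i = {} then 0 else diameter (C i) ^ k)))"

definition hausdorff_outer :: "nat \<Rightarrow> 'a::metric_space set \<Rightarrow> ennreal" where
  "hausdorff_outer k A = (SUP \<delta>\<in>{0<..}. hausdorff_pre k \<delta> A)"

definition hausdorff_measure :: "nat \<Rightarrow> 'a::euclidean_space measure" where
  "hausdorff_measure k = measure_of UNIV (sets borel)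
     (\<lambda>A. ennreal (unit_ball_vol (real k) / 2 ^ k) * hausdorff_outer k A)"

definition ot_data :: "complex^'n \<Rightarrow> real \<Rightarrow> (complex^'n \<Rightarrow> complex) \<Rightarrow> (complex^'n \<Rightarrow> ereal) \<Rightarrow> bool" where
  "ot_data c r h \<phi> \<longleftrightarrow> 0 < r \<and> holo_n h (ball c r) \<and> (\<forall>z\<in>ball c r. cmod (h z) \<le> 1) \<and>
     (\<forall>z\<in>ball c r. h z = 0 \<longrightarrow> dh_norm_sq h z \<noteq> 0) \<and> psh_on (ball c r) \<phi> \<and>
     (\<exists>z\<in>ball c r. h z = 0 \<and> \<phi> z \<noteq> -\<infinity>)"

definition zero_set :: "complex^'n \<Rightarrow> real \<Rightarrow> (complex^'n \<Rightarrow> complex) \<Rightarrow> (complex^'n) set" where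
  "zero_set c r h = {z\<in>ball c r. h z = 0}"

definition OT_holds :: "'n::finite itself \<Rightarrow> real \<Rightarrow> bool" where
  "OT_holds _ C0 \<longleftrightarrow> (\<forall>(c::complex^'n) r h \<phi> f. ot_data c r h \<phi> \<and> holo_on_subvariety f (zero_set c r h) \<longrightarrow>
     (\<exists>F. holo_n F (ball c r) \<and> (\<forall>z\<in>zero_set c r h. F z = f z) \<and>
        (\<integral>\<^sup>+ z\<in>ball c r. ennreal ((cmod (F z))^2) * exp_neg (\<phi> z) \<partial>lborel)
          \<le> ennreal C0 * (\<integral>\<^sup>+ z\<in>zero_set c r h. ennreal ((cmod (f z))^2) * exp_neg (\<phi> z)
                 / ennreal (dh_norm_sq h z) \<partial>hausdorff_measure (2 * CARD('n) - 2))))"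

end

theory Submission
  imports Defs "HOL-Complex_Analysis.Complex_Analysis"
begin

text \<open>
  Put \<open>p = 2/m\<close> and let \<open>K\<close> be the right-hand side of the desired estimate. Fix a ball \<open>B\<close> slightly
  smaller than \<open>\<Omega>\<close> and replace \<open>\<phi>\<close> by the bounded-below weight \<open>max \<phi> (-j)\<close>. Given an extension
  \<open>G\<close> of \<open>f\<close> to \<open>B\<close>, the Ohsawa--Takegoshi theorem for the weight
  \<open>max \<phi> (-j) + (2 - p) ln (max |G| d)\<close> yields a new extension \<open>F\<close>, and the pointwise inequality of
  arithmetic and geometric means gives
  \<open>\<integral> |F|^p e^-\<phi> \<le> K/m + (1 - 1/m) \<integral> (max |G| d)^p e^-\<phi>\<close>. Hence the infimum \<open>A\<close> of
  \<open>\<integral> |F|^p e^-\<phi>\<close> over all extensions satisfies \<open>A \<le> K/m + (1 - 1/m) A\<close>, that is \<open>A \<le> K\<close>, provided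
  that \<open>A\<close> is finite; the same inequality with \<open>G = 0\<close> and \<open>d\<close> a bound for \<open>|f|\<close> shows that it is.
  Letting the balls exhaust \<open>\<Omega>\<close> and \<open>j\<close> tend to infinity, Montel's theorem and Fatou's lemma produce the
  extension. The local bounds needed for Montel's theorem come from the sub-mean value property of
  \<open>|F|^p\<close>, which like the plurisubharmonicity of the weight rests on Jensen's inequality for \<open>ln |g|\<close>.
\<close>


section \<open>Jensen's inequality on the unit circle\<close>

text \<open>On the unit circle \<open>cnj z\<close> equals \<open>1 / z\<close>, so a polynomial in
  the real and imaginary parts becomes a Laurent polynomial there; the factor \<open>z ^ N\<close>
  clears its negative powers.\<close>

lemma real_polynomial_function_on_circle:
  fixes g :: "complex \<Rightarrow> real"
  assumes "real_polynomial_function g"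
  shows "\<exists>(P::complex poly) N. \<forall>z. cmod z = 1 \<longrightarrow> of_real (g z) * z ^ N = poly P z"
  using assms
proof (induction rule: real_polynomial_function.induct)
  case (linear g)
  interpret bounded_linear g by fact
  \<comment> \<open>These are the coefficients of \<open>z + cnj z\<close> and
    \<open>z - cnj z\<close> once \<open>Re z\<close> and \<open>Im z\<close> are expressed through
    \<open>z\<close> and \<open>cnj z\<close>.\<close>
  let ?a = "of_real (g 1) / 2 :: complex" and ?b = "of_real (g \<i>) / (2 * \<i>) :: complex"
  have "of_real (g z) * z ^ 1 = poly [:?a - ?b, 0, ?a + ?b:] z" if "cmod z = 1" for z
  proof -
    have "z = Re z *\<^sub>R 1 + Im z *\<^sub>R \<i>"
      by (simp add: complex_eq_iff)
    then have "g z = Re z * g 1 + Im z * g \<i>"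
      by (metis add scaleR real_scaleR_def)
    then have gz: "of_real (g z) = of_real (Re z) * of_real (g 1) + of_real (Im z) * (of_real (g \<i>) :: complex)"
      by simp
    have re: "of_real (Re z) = (z + cnj z) / 2" and im: "of_real (Im z) = (z - cnj z) / (2 * \<i>)"
      by (auto simp: complex_eq_iff)
    have "cnj z * z = 1"
      using that complex_norm_square[of z] by (simp add: mult.commute)
    have "of_real (g z) * z = ?a * (z * z + cnj z * z) + ?b * (z * z - cnj z * z)"
      unfolding gz re im by (simp add: field_simps)
    also have "cnj z * z = 1" by fact
    finally have "of_real (g z) * z = ?a * (z * z + 1) + ?b * (z * z - 1)" .
    then show ?thesis by (simp add: algebra_simps add_divide_distrib diff_divide_distrib)
  qed
  then show ?case by blast
next
  case (const c)
  have "of_real c * z ^ 0 = poly [:of_real c:] z" for z :: complex by simp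
  then show ?case by blast
next
  case (add f g)
  then obtain P N Q M where
    PQ: "\<And>z. cmod z = 1 \<Longrightarrow> of_real (f z) * z ^ N = poly P z"
        "\<And>z. cmod z = 1 \<Longrightarrow> of_real (g z) * z ^ M = poly Q z" by blast
  have "of_real (f z + g z) * z ^ (N + M) = poly (P * monom 1 M + Q * monom 1 N) z"
    if "cmod z = 1" for z
    by (simp add: PQ[OF that, symmetric] poly_monom algebra_simps power_add)
  then show ?case by blast
next
  case (mult f g)
  then obtain P N Q M where
    PQ: "\<And>z. cmod z = 1 \<Longrightarrow> of_real (f z) * z ^ N = poly P z"
        "\<And>z. cmod z = 1 \<Longrightarrow> of_real (g z) * z ^ M = poly Q z" by blast
  have "of_real (f z * g z) * z ^ (N + M) = poly (P * Q) z" if "cmod z = 1" for z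
    by (simp add: PQ[OF that, symmetric] algebra_simps power_add)
  then show ?case by blast
qed

text \<open>On the circle a term with a negative exponent is the conjugate of a term with a positive
  one. Conjugation does not change the real part, so all exponents can be made nonnegative and the
  result is entire.\<close>

lemma real_polynomial_function_on_circle_Re:
  fixes g :: "complex \<Rightarrow> real"
  assumes "real_polynomial_function g"
  obtains p where "p holomorphic_on UNIV" "\<And>z. cmod z = 1 \<Longrightarrow> Re (p z) = g z"
proof -
  obtain P N where P: "\<And>z. cmod z = 1 \<Longrightarrow> of_real (g z) * z ^ N = poly P z"
    using real_polynomial_function_on_circle[OF assms] by blast
  define p where "p z = (\<Sum>k\<le>degree P. if N \<le> k then coeff P k * z ^ (k - N)
                                          else cnj (coeff P k) * z ^ (N - k))" for z
  have "p holomorphic_on UNIV"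
    unfolding p_def
  proof (intro holomorphic_on_sum)
    fix k show "(\<lambda>z. if N \<le> k then coeff P k * z ^ (k - N) else cnj (coeff P k) * z ^ (N - k))
      holomorphic_on UNIV"
      by (cases "N \<le> k") (auto intro!: holomorphic_intros)
  qed
  moreover have "Re (p z) = g z" if z: "cmod z = 1" for z
  proof -
    have zc: "z * cnj z = 1" using z complex_norm_square[of z] by simp
    then have zp: "z ^ n * cnj z ^ n = 1" for n by (metis power_mult_distrib power_one)
    have summand: "Re (coeff P k * z ^ k * cnj z ^ N) =
       Re (if N \<le> k then coeff P k * z ^ (k - N) else cnj (coeff P k) * z ^ (N - k))" for k
    proof (cases "N \<le> k")
      case True
      then have "z ^ k * cnj z ^ N = z ^ (k - N)"
        using zp[of N] by (metis mult.assoc mult.right_neutral le_add_diff_inverse2 power_add)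
      with True show ?thesis by (simp add: mult.assoc)
    next
      case False
      then have "cnj z ^ N = cnj z ^ k * cnj z ^ (N - k)"
        by (simp flip: power_add)
      then have "z ^ k * cnj z ^ N = cnj (z ^ (N - k))"
        using zp[of k] by (simp flip: mult.assoc)
      then have "coeff P k * z ^ k * cnj z ^ N = cnj (cnj (coeff P k) * z ^ (N - k))"
        by (simp add: mult.assoc)
      with False show ?thesis by (metis complex_cnj(1) cnj.simps(1))
    qed
    have "of_real (g z) = of_real (g z) * z ^ N * cnj z ^ N"
      by (simp add: mult.assoc zp)
    also have "\<dots> = (\<Sum>k\<le>degree P. coeff P k * z ^ k * cnj z ^ N)"
      by (simp add: P[OF z] poly_altdef sum_distrib_right)
    finally have "g z = Re \<dots>" by (metis Re_complex_of_real)
    then show ?thesis by (simp only: Re_sum summand p_def)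
  qed
  ultimately show thesis by (rule that)
qed

text \<open>Stone--Weierstrass supplies the polynomial. Up to a small error, \<open>Re p\<close>
  takes the place of the solution of the Dirichlet problem with boundary values
  \<open>u\<close>.\<close>

lemma continuous_on_circle_approx_Re:
  fixes u :: "complex \<Rightarrow> real"
  assumes "continuous_on (sphere 0 1) u" "e > 0"
  obtains p where "p holomorphic_on UNIV" "\<And>z. cmod z = 1 \<Longrightarrow> \<bar>u z - Re (p z)\<bar> < e"
proof -
  obtain g where g: "real_polynomial_function g" "\<And>x. x \<in> sphere 0 1 \<Longrightarrow> \<bar>u x - g x\<bar> < e"
    using Stone_Weierstrass_real_polynomial_function[OF _ assms] by auto
  obtain p where "p holomorphic_on UNIV" "\<And>z. cmod z = 1 \<Longrightarrow> Re (p z) = g z"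
    using real_polynomial_function_on_circle_Re[OF g(1)] by blast
  with g that show thesis by simp
qed

text \<open>Cauchy's formula at the centre: the derivative \<open>\<i> * cis t\<close> of the
  parametrization cancels the denominator \<open>cis t\<close> up to the factor
  \<open>\<i>\<close>.\<close>

lemma has_integral_circle_mean:
  assumes "p holomorphic_on UNIV"
  shows "((\<lambda>t. p (cis t)) has_integral (of_real (2 * pi) * p 0)) {0..2*pi}"
proof -
  have "((\<lambda>u. p u / (u - 0)) has_contour_integral (2 * of_real pi * \<i> * p 0)) (circlepath 0 1)"
    using assms by (intro Cauchy_integral_circlepath_simple) (auto intro: holomorphic_on_subset)
  then have "((\<lambda>t. p (cis t) / cis t * \<i> * cis t) has_integral (2 * of_real pi * \<i> * p 0)) {0..2*pi}"
    unfolding circlepath_def by (subst (asm) has_contour_integral_part_circlepath_iff) auto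
  then have "((\<lambda>t. (- \<i>) * (p (cis t) / cis t * \<i> * cis t)) has_integral ((- \<i>) * (2 * of_real pi * \<i> * p 0))) {0..2*pi}"
    by (rule has_integral_mult_right)
  then show ?thesis by (simp add: algebra_simps)
qed

text \<open>If \<open>Re p\<close> approximates \<open>ln (max |g| d)\<close> from above on the circle, then \<open>g e^-p\<close> and \<open>d e^-p\<close> are
  bounded by 1 there, hence also at the origin, where \<open>Re p\<close> is its own circle mean.\<close>
lemma ln_max_cmod_le_circle_mean:
  assumes g: "g holomorphic_on U" and U: "open U" "cball 0 1 \<subseteq> U" and d: "d > 0"
  shows "2 * pi * ln (max (cmod (g 0)) d) \<le> integral {0..2*pi} (\<lambda>t. ln (max (cmod (g (cis t))) d))"
proof (rule field_le_epsilon)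
  fix e :: real assume "e > 0"
  define u where "u z = ln (max (cmod (g z)) d)" for z
  have cg: "continuous_on (cball 0 1) g"
    using g U by (meson continuous_on_subset holomorphic_on_imp_continuous_on)
  have pos: "max (cmod w) d > 0" for w using d by simp
  have "continuous_on (sphere 0 1) u"
    unfolding u_def using pos
    by (intro continuous_intros continuous_on_subset[OF cg]) (auto simp: less_imp_neq[symmetric] max_def)
  \<comment> \<open>After integration over an interval of length \<open>2 * pi\<close> the error
    costs \<open>e / 2\<close> twice: once at the origin and once on the circle.\<close>
  then obtain p where p: "p holomorphic_on UNIV" "\<And>z. cmod z = 1 \<Longrightarrow> \<bar>u z - Re (p z)\<bar> < e / (4 * pi)"
    using continuous_on_circle_approx_Re[of u "e / (4 * pi)"] \<open>e > 0\<close> by auto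
  let ?c = "of_real (e / (4 * pi)) :: complex"
  \<comment> \<open>The shift by \<open>?c\<close> turns the approximation of \<open>u\<close> into
    a majorant on the circle. The claim is used for \<open>g\<close> itself and for the constant
    \<open>d\<close>.\<close>
  have maxi: "cmod (h 0 * exp (- p 0 - ?c)) \<le> 1"
    if h: "h holomorphic_on U" and le: "\<And>z. cmod z = 1 \<Longrightarrow> cmod (h z) \<le> exp (u z)" for h
  proof (rule maximum_modulus_frontier[of "\<lambda>z. h z * exp (- p z - ?c)" "cball 0 1"])
    have hol: "(\<lambda>z. h z * exp (- p z - ?c)) holomorphic_on cball 0 1"
      using p(1) h U by (intro holomorphic_intros) (auto intro: holomorphic_on_subset)
    then show "(\<lambda>z. h z * exp (- p z - ?c)) holomorphic_on interior (cball 0 1)"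
      by (rule holomorphic_on_subset) auto
    show "continuous_on (closure (cball 0 1)) (\<lambda>z. h z * exp (- p z - ?c))"
      using hol by (simp add: holomorphic_on_imp_continuous_on)
    show "cmod (h z * exp (- p z - ?c)) \<le> 1" if "z \<in> frontier (cball 0 1)" for z
    proof -
      have z: "cmod z = 1" using that by simp
      have "cmod (h z * exp (- p z - ?c)) \<le> exp (u z) * exp (Re (- p z - ?c))"
        unfolding norm_mult norm_exp_eq_Re using le[OF z] by (intro mult_right_mono) auto
      also have "\<dots> = exp (u z - Re (p z) - e / (4 * pi))" by (simp flip: exp_add)
      also have "\<dots> \<le> 1" using p(2)[OF z] by (simp; linarith)
      finally show ?thesis .
    qed
  qed auto
  have expu: "exp (u z) = max (cmod (g z)) d" for z using pos by (simp add: u_def)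
  have "cmod (g 0) * exp (- Re (p 0) - e / (4 * pi)) \<le> 1"
    using maxi[OF g] by (simp add: norm_mult norm_exp_eq_Re expu)
  moreover have "d * exp (- Re (p 0) - e / (4 * pi)) \<le> 1"
    using maxi[of "\<lambda>_. of_real d"] d by (simp add: norm_mult norm_exp_eq_Re expu)
  ultimately have "max (cmod (g 0)) d * exp (- Re (p 0) - e / (4 * pi)) \<le> 1"
    by (simp add: max_def)
  then have "exp (u 0 - Re (p 0) - e / (4 * pi)) \<le> 1"
    by (simp add: expu[symmetric] algebra_simps flip: exp_add)
  then have u0: "u 0 \<le> Re (p 0) + e / (4 * pi)" by simp
  have "((\<lambda>t. Re (p (cis t))) has_integral Re (of_real (2 * pi) * p 0)) {0..2*pi}"
    by (rule has_integral_Re[OF has_integral_circle_mean[OF p(1)]])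
  then have "((\<lambda>t. Re (p (cis t)) - e / (4 * pi)) has_integral (2 * pi * Re (p 0) - (2 * pi) * (e / (4 * pi)))) {0..2*pi}"
    using has_integral_const_real[of "e / (4 * pi)" 0 "2*pi"]
    by (intro has_integral_diff) (auto simp: mult.commute)
  moreover have "continuous_on {0..2*pi} (\<lambda>t. u (cis t))"
    by (rule continuous_on_compose2[OF \<open>continuous_on (sphere 0 1) u\<close>]) (auto intro!: continuous_intros)
  then have "((\<lambda>t. u (cis t)) has_integral (integral {0..2*pi} (\<lambda>t. u (cis t)))) {0..2*pi}"
    by (intro integrable_integral integrable_continuous_real)
  ultimately have "2 * pi * Re (p 0) - (2 * pi) * (e / (4 * pi)) \<le> integral {0..2*pi} (\<lambda>t. u (cis t))"
  proof (rule has_integral_le)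
    fix t show "Re (p (cis t)) - e / (4 * pi) \<le> u (cis t)" using p(2)[of "cis t"] by simp
  qed
  moreover have "2 * pi * u 0 \<le> 2 * pi * (Re (p 0) + e / (4 * pi))"
    using u0 by (intro mult_left_mono) auto
  moreover have "2 * pi * (e / (4 * pi)) = e / 2" by simp
  ultimately show "2 * pi * ln (max (cmod (g 0)) d) \<le> integral {0..2*pi} (\<lambda>t. ln (max (cmod (g (cis t))) d)) + e"
    using \<open>e > 0\<close> unfolding u_def[symmetric] distrib_left by linarith
qed

section \<open>Plurisubharmonic weights\<close>

lemma norm_cvector_scalar_mult: "norm (c *s v) = cmod c * norm (v :: complex^'n)"
  by (simp add: norm_vec_def L2_set_def vector_scalar_mult_def norm_mult power_mult_distrib
      real_sqrt_mult flip: sum_distrib_left)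

lemma bounded_linear_cvector_scalar_mult_right: "bounded_linear (\<lambda>v::complex^'n. c *s v)"
  by (rule bounded_linear_intro[where K="cmod c"])
     (auto simp: norm_cvector_scalar_mult vec_eq_iff algebra_simps)

lemma bounded_linear_cvector_scalar_mult_left: "bounded_linear (\<lambda>c. c *s (v::complex^'n))"
  by (rule bounded_linear_intro[where K="norm v"])
     (auto simp: norm_cvector_scalar_mult vec_eq_iff algebra_simps)

lemmas continuous_on_cvector_scalar_mult_left [continuous_intros] =
  bounded_linear.continuous_on[OF bounded_linear_cvector_scalar_mult_left]

lemma holo_nE:
  assumes "holo_n F U" "z \<in> U"
  obtains L where "(F has_derivative L) (at z)" "\<And>c v. L (c *s v) = c * L v"
  using assms unfolding holo_n_def by blast

lemma holo_n_imp_continuous_on: "holo_n F U \<Longrightarrow> continuous_on U F"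
  unfolding holo_n_def by (meson continuous_at_imp_continuous_on has_derivative_continuous)

lemma holo_n_subset: "holo_n F U \<Longrightarrow> open W \<Longrightarrow> W \<subseteq> U \<Longrightarrow> holo_n F W"
  unfolding holo_n_def by blast

lemma holo_n_const: "open U \<Longrightarrow> holo_n (\<lambda>_. c) U"
  unfolding holo_n_def by (auto intro!: exI[of _ "\<lambda>_. 0"])

lemma holo_n_diff:
  assumes "holo_n F U" "holo_n G U" shows "holo_n (\<lambda>z. F z - G z) U"
  unfolding holo_n_def
proof (intro conjI ballI)
  show "open U" using assms by (simp add: holo_n_def)
  fix z assume "z \<in> U"
  obtain L where L: "(F has_derivative L) (at z)" "\<And>c v. L (c *s v) = c * L v"
    using holo_nE[OF assms(1) \<open>z \<in> U\<close>] by blast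
  obtain M where M: "(G has_derivative M) (at z)" "\<And>c v. M (c *s v) = c * M v"
    using holo_nE[OF assms(2) \<open>z \<in> U\<close>] by blast
  from L M show "\<exists>L. ((\<lambda>z. F z - G z) has_derivative L) (at z) \<and> (\<forall>c v. L (c *s v) = c * L v)"
    by (intro exI[of _ "\<lambda>x. L x - M x"]) (auto intro!: has_derivative_diff simp: algebra_simps)
qed

text \<open>By complex linearity \<open>L (x *s b) = x * L b\<close>, so the real derivative of the
  composition is multiplication by the complex number \<open>L b\<close>.\<close>

lemma holo_n_line_has_field_derivative:
  fixes a b :: "complex^'n"
  assumes "(F has_derivative L) (at (a + \<zeta> *s b))" "\<And>c v. L (c *s v) = c * L v"
  shows "((\<lambda>\<zeta>. F (a + \<zeta> *s b)) has_field_derivative L b) (at \<zeta>)"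
proof -
  have "((\<lambda>\<zeta>. a + \<zeta> *s b) has_derivative (\<lambda>x. x *s b)) (at \<zeta>)"
    using has_derivative_add[OF has_derivative_const[of a]
        bounded_linear_imp_has_derivative[OF bounded_linear_cvector_scalar_mult_left[of b]]]
    by simp
  from has_derivative_compose[OF this assms(1)]
  show ?thesis by (simp add: has_field_derivative_def assms(2) mult_commute_abs)
qed

lemma open_line_vimage: "open U \<Longrightarrow> open {\<zeta>. a + \<zeta> *s b \<in> (U :: (complex^'n) set)}"
proof -
  assume "open U"
  then have "open ((\<lambda>\<zeta>. a + \<zeta> *s b) -` U)" by (rule open_vimage) (intro continuous_intros)
  then show ?thesis by (simp add: vimage_def)
qed

text \<open>Restriction to complex lines makes the one-variable theory (Jensen's inequality,
  Cauchy's estimate) available for functions satisfying \<open>holo_n\<close>.\<close>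

lemma holo_n_line:
  assumes "holo_n F U"
  shows "(\<lambda>\<zeta>. F (a + \<zeta> *s b)) holomorphic_on {\<zeta>. a + \<zeta> *s b \<in> U}"
proof -
  have o: "open {\<zeta>. a + \<zeta> *s b \<in> U}" using assms open_line_vimage by (auto simp: holo_n_def)
  show ?thesis
    unfolding holomorphic_on_open[OF o]
  proof clarify
    fix \<zeta> assume "a + \<zeta> *s b \<in> U"
    then obtain L where "(F has_derivative L) (at (a + \<zeta> *s b))" "\<And>c v. L (c *s v) = c * L v"
      using holo_nE[OF assms] by blast
    from holo_n_line_has_field_derivative[OF this]
    show "\<exists>f'. ((\<lambda>\<zeta>. F (a + \<zeta> *s b)) has_field_derivative f') (at \<zeta>)" by blast
  qed
qed

section \<open>Upper semicontinuous functions and their circle means\<close>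

definition usc_on :: "'a::topological_space set \<Rightarrow> ('a \<Rightarrow> real) \<Rightarrow> bool" where
  "usc_on U u \<longleftrightarrow> open U \<and> (\<forall>c. open {z\<in>U. u z < c})"

text \<open>The sets where \<open>u z < real n\<close> are an open cover of \<open>K\<close>, and a
  finite subcover gives the bound.\<close>

lemma usc_on_bounded_above:
  assumes "usc_on U u" "compact K" "K \<subseteq> U"
  obtains M where "\<And>z. z \<in> K \<Longrightarrow> u z \<le> M"
proof -
  have "open {z\<in>U. u z < c}" for c using assms by (simp add: usc_on_def)
  moreover have "K \<subseteq> (\<Union>n. {z\<in>U. u z < real n})" using assms(3) reals_Archimedean2 by blast
  ultimately obtain D where D: "finite D" "K \<subseteq> (\<Union>n\<in>D. {z\<in>U. u z < real n})"
    by (rule compactE_image[OF assms(2)]) auto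
  show thesis
  proof (rule that)
    fix z assume "z \<in> K"
    then obtain n where "n \<in> D" "u z < real n" using D by auto
    moreover have "real n \<le> Max (insert 0 (real ` D))" using D \<open>n \<in> D\<close> by (intro Max_ge) auto
    ultimately show "u z \<le> Max (insert 0 (real ` D))" by simp
  qed
qed

text \<open>The sum is below \<open>c\<close> exactly when some \<open>x\<close> lies strictly
  between \<open>u z\<close> and \<open>c - w z\<close>, which writes the sublevel set as a union of
  open sets.\<close>

lemma usc_on_add_continuous:
  assumes "usc_on U u" "continuous_on U w"
  shows "usc_on U (\<lambda>z. u z + w z)"
proof -
  have U: "open U" "\<And>c. open {z\<in>U. u z < c}" using assms by (auto simp: usc_on_def)
  have w: "open {z\<in>U. w z < c}" for c
    using continuous_open_preimage[OF assms(2) U(1) open_lessThan[of c]]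
    by (simp add: vimage_def Int_def)
  have "{z\<in>U. u z + w z < c} = (\<Union>x. {z\<in>U. u z < x} \<inter> {z\<in>U. w z < c - x})" for c
  proof safe
    fix z assume "z \<in> U" "u z + w z < c"
    then obtain x where "u z < x" "x < c - w z" using dense[of "u z" "c - w z"] by auto
    with \<open>z \<in> U\<close> show "z \<in> (\<Union>x. {z\<in>U. u z < x} \<inter> {z\<in>U. w z < c - x})"
      by (auto intro!: exI[of _ x])
  qed auto
  then show ?thesis unfolding usc_on_def using U w by (auto intro!: open_UN open_Int)
qed

lemma usc_on_measurable:
  assumes "usc_on U u" shows "u \<in> borel_measurable (restrict_space borel U)"
  unfolding borel_measurable_iff_less
proof
  fix c
  have "open {z\<in>U. u z < c}" using assms by (auto simp: usc_on_def)
  then show "{z \<in> space (restrict_space borel U). u z < c} \<in> sets (restrict_space borel U)"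
    by (auto simp: sets_restrict_space space_restrict_space image_iff intro!: bexI[of _ "{z\<in>U. u z < c}"])
qed

lemma usc_on_compose_measurable:
  assumes "usc_on U u" "continuous_on UNIV g" "\<And>t. g t \<in> U"
  shows "(\<lambda>t. u (g t)) \<in> borel_measurable borel"
proof -
  have "open (g -` {z\<in>U. u z < c})" for c
    using assms by (intro open_vimage) (auto simp: usc_on_def)
  then have "open {t. u (g t) < c}" for c using assms(3) by (simp add: vimage_def)
  then show ?thesis unfolding borel_measurable_iff_less by auto
qed

lemma circle_mean_mono:
  assumes "\<And>t. u (a + cis t *s b) \<le> v (a + cis t *s b)"
  shows "circle_mean u a b \<le> circle_mean v a b"
  unfolding circle_mean_def using assms
  by (intro ereal_divide_right_mono ereal_minus_mono)
     (auto simp: less_eq_ennreal.rep_eq[symmetric] intro!: nn_integral_mono mult_right_mono e2ennreal_mono)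

text \<open>Integrability makes the integrals of the positive and the negative part finite, so the
  subtraction in \<open>ereal\<close> is an honest subtraction of reals.\<close>

lemma circle_mean_real:
  fixes u :: "complex^'n \<Rightarrow> real"
  assumes int: "set_integrable lborel {0..2*pi} (\<lambda>t. u (a + cis t *s b))"
  shows "circle_mean (\<lambda>z. ereal (u z)) a b = ereal ((LINT t:{0..2*pi}|lborel. u (a + cis t *s b)) / (2 * pi))"
proof -
  define w where "w t = indicator {0..2*pi} t * u (a + cis t *s b)" for t
  have w: "integrable lborel w" using int by (simp add: set_integrable_def w_def[abs_def])
  have 1: "(\<integral>\<^sup>+ t\<in>{0..2*pi}. e2ennreal (ereal (u (a + cis t *s b))) \<partial>lborel) = (\<integral>\<^sup>+ t. ennreal (w t) \<partial>lborel)"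
    by (intro nn_integral_cong) (auto simp: w_def split: split_indicator)
  have 2: "(\<integral>\<^sup>+ t\<in>{0..2*pi}. e2ennreal (- ereal (u (a + cis t *s b))) \<partial>lborel) = (\<integral>\<^sup>+ t. ennreal (- w t) \<partial>lborel)"
    by (intro nn_integral_cong) (auto simp: w_def split: split_indicator)
  have fin: "(\<integral>\<^sup>+ t. ennreal (w t) \<partial>lborel) < \<infinity>" "(\<integral>\<^sup>+ t. ennreal (- w t) \<partial>lborel) < \<infinity>"
    using w integrableD(2,3) by (auto simp: real_integrable_def top.not_eq_extremum)
  have e: "enn2ereal x = ereal (enn2real x)" if "x < \<infinity>" for x
    using that by (cases x) auto
  have "integral\<^sup>L lborel w = enn2real (\<integral>\<^sup>+ t. ennreal (w t) \<partial>lborel) - enn2real (\<integral>\<^sup>+ t. ennreal (- w t) \<partial>lborel)"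
    by (rule real_lebesgue_integral_def[OF w])
  moreover have "integral\<^sup>L lborel w = (LINT t:{0..2*pi}|lborel. u (a + cis t *s b))"
    by (simp add: set_lebesgue_integral_def w_def[abs_def])
  ultimately show ?thesis
    unfolding circle_mean_def 1 2 e[OF fin(1)] e[OF fin(2)] by simp
qed

text \<open>On the compact circle \<open>u\<close> is bounded above by semicontinuity and below by
  \<open>B\<close>; a bounded measurable function on a bounded interval is integrable.\<close>

lemma usc_on_circle_integrable:
  fixes u :: "complex^'n \<Rightarrow> real"
  assumes u: "usc_on U u" and lb: "\<And>z. z \<in> U \<Longrightarrow> B \<le> u z"
    and disc: "\<And>\<zeta>. cmod \<zeta> \<le> 1 \<Longrightarrow> a + \<zeta> *s b \<in> U"
  shows "set_integrable lborel {0..2*pi} (\<lambda>t. u (a + cis t *s b))"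
proof -
  have cont: "continuous_on UNIV (\<lambda>t. a + cis t *s b)" by (intro continuous_intros)
  have "compact ((\<lambda>t. a + cis t *s b) ` {0..2*pi})"
    by (intro compact_continuous_image continuous_on_subset[OF cont]) auto
  moreover have "(\<lambda>t. a + cis t *s b) ` {0..2*pi} \<subseteq> U" using disc by auto
  ultimately obtain M where M: "\<And>z. z \<in> (\<lambda>t. a + cis t *s b) ` {0..2*pi} \<Longrightarrow> u z \<le> M"
    using usc_on_bounded_above[OF u] by blast
  have meas: "(\<lambda>t. u (a + cis t *s b)) \<in> borel_measurable borel"
    by (rule usc_on_compose_measurable[OF u cont]) (use disc in auto)
  show ?thesis
    unfolding set_integrable_def
  proof (rule integrableI_bounded_set_indicator)
    show "AE t in lborel. t \<in> {0..2*pi} \<longrightarrow> norm (u (a + cis t *s b)) \<le> max \<bar>M\<bar> \<bar>B\<bar>"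
    proof (intro AE_I2 impI)
      fix t assume "t \<in> {0..2*pi}"
      then have "u (a + cis t *s b) \<le> M" by (intro M) auto
      then show "norm (u (a + cis t *s b)) \<le> max \<bar>M\<bar> \<bar>B\<bar>"
        using lb[of "a + cis t *s b"] disc[of "cis t"] by auto
    qed
  qed (use meas in auto)
qed

section \<open>Truncating the weight from below\<close>

text \<open>Where \<open>\<phi>\<close> is \<open>\<infinity>\<close>, this takes the junk value 0 of \<open>real_of_ereal\<close>.\<close>
definition cutoff :: "('a \<Rightarrow> ereal) \<Rightarrow> real \<Rightarrow> 'a \<Rightarrow> real" where
  "cutoff \<phi> j z = real_of_ereal (max (\<phi> z) (ereal (- j)))"

lemma ereal_cutoff: "\<phi> z \<noteq> \<infinity> \<Longrightarrow> ereal (cutoff \<phi> j z) = max (\<phi> z) (ereal (- j))"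
  unfolding cutoff_def by (cases "\<phi> z") (auto simp: max_def)

lemma cutoff_ge: "\<phi> z \<noteq> \<infinity> \<Longrightarrow> - j \<le> cutoff \<phi> j z"
  using ereal_cutoff[of \<phi> z j] by (metis ereal_less_eq(3) max.cobounded2)

lemma cutoff_antimono: "\<phi> z \<noteq> \<infinity> \<Longrightarrow> i \<le> j \<Longrightarrow> cutoff \<phi> j z \<le> cutoff \<phi> i z"
  using ereal_cutoff[of \<phi> z j] ereal_cutoff[of \<phi> z i]
  by (metis ereal_less_eq(3) max.mono neg_le_iff_le order_refl)

lemma exp_cutoff_le_exp_neg: "\<phi> z \<noteq> \<infinity> \<Longrightarrow> ennreal (exp (- cutoff \<phi> j z)) \<le> exp_neg (\<phi> z)"
  unfolding cutoff_def exp_neg_def by (cases "\<phi> z") (auto simp: max_def intro!: ennreal_leI)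

text \<open>Where \<open>\<phi> z\<close> is finite, the truncations eventually equal it. Where it
  is \<open>-\<infinity>\<close>, they are \<open>- real j\<close>, and
  \<open>exp (real j) \<ge> real j\<close> is unbounded. This feeds the final monotone
  convergence.\<close>

lemma SUP_exp_cutoff:
  assumes "\<phi> z \<noteq> \<infinity>"
  shows "(SUP j. ennreal (exp (- cutoff \<phi> (real j) z))) = exp_neg (\<phi> z)"
proof (rule antisym[OF SUP_least])
  show "exp_neg (\<phi> z) \<le> (SUP j. ennreal (exp (- cutoff \<phi> (real j) z)))"
  proof (cases "\<phi> z")
    case (real x)
    obtain j where "- x \<le> real j" using real_arch_simple by blast
    then have "cutoff \<phi> (real j) z = x" using real by (auto simp: cutoff_def max_def)
    then show ?thesis using real by (intro SUP_upper2[of j]) (auto simp: exp_neg_def)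
  next
    case MInf
    have "ennreal (real n) \<le> (SUP j. ennreal (exp (- cutoff \<phi> (real j) z)))" for n
    proof (rule SUP_upper2)
      have "real n \<le> exp (real n)" using exp_ge_add_one_self[of "real n"] by linarith
      then show "ennreal (real n) \<le> ennreal (exp (- cutoff \<phi> (real n) z))"
        using MInf by (auto simp: cutoff_def intro!: ennreal_leI)
    qed simp
    then have "(SUP n. of_nat n :: ennreal) \<le> (SUP j. ennreal (exp (- cutoff \<phi> (real j) z)))"
      by (intro SUP_least) (simp add: ennreal_of_nat_eq_real_of_nat)
    then have "(SUP j. ennreal (exp (- cutoff \<phi> (real j) z))) = \<infinity>"
      by (simp add: ennreal_SUP_of_nat_eq_top top_unique)
    then show ?thesis by (metis infinity_ennreal_def top_greatest)
  qed (use assms in auto)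
qed (rule exp_cutoff_le_exp_neg[of \<phi> z, OF assms])

lemma usc_on_cutoff:
  assumes "psh_on U \<phi>" shows "usc_on U (cutoff \<phi> j)"
proof -
  have U: "open U" and fin: "\<And>z. z \<in> U \<Longrightarrow> \<phi> z \<noteq> \<infinity>"
    and o: "\<And>c. openin (top_of_set U) {z\<in>U. \<phi> z < c}"
    using assms by (auto simp: psh_on_def)
  have "cutoff \<phi> j z < c \<longleftrightarrow> \<phi> z < ereal c \<and> - j < c" if "z \<in> U" for z c
  proof -
    have "cutoff \<phi> j z < c \<longleftrightarrow> max (\<phi> z) (ereal (- j)) < ereal c"
      using ereal_cutoff[of \<phi> z j, OF fin[OF that]] by (metis less_ereal.simps(1))
    then show ?thesis by simp
  qed
  then have "{z\<in>U. cutoff \<phi> j z < c} = (if - j < c then {z\<in>U. \<phi> z < ereal c} else {})" for c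
    by auto
  moreover have "open {z\<in>U. \<phi> z < ereal c}" for c
    using o U openin_open_eq by blast
  ultimately show ?thesis unfolding usc_on_def using U by auto
qed

text \<open>The mean of the truncation dominates both entries of the maximum at \<open>a\<close>:
  the constant \<open>- j\<close>, because the truncation is at least \<open>- j\<close>, and
  \<open>\<phi> a\<close>, because the truncation majorizes \<open>\<phi>\<close>.\<close>

lemma cutoff_le_circle_mean:
  assumes psh: "psh_on U \<phi>" and disc: "\<And>\<zeta>. cmod \<zeta> \<le> 1 \<Longrightarrow> a + \<zeta> *s b \<in> U"
  shows "2 * pi * cutoff \<phi> j a \<le> (LINT t:{0..2*pi}|lborel. cutoff \<phi> j (a + cis t *s b))"
proof -
  have fin: "\<And>z. z \<in> U \<Longrightarrow> \<phi> z \<noteq> \<infinity>" using psh by (auto simp: psh_on_def)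
  have int: "set_integrable lborel {0..2*pi} (\<lambda>t. cutoff \<phi> j (a + cis t *s b))"
    by (rule usc_on_circle_integrable[OF usc_on_cutoff[OF psh] cutoff_ge disc]) (use fin in auto)
  have aU: "a \<in> U" using disc[of 0] by (simp)
  let ?I = "LINT t:{0..2*pi}|lborel. cutoff \<phi> j (a + cis t *s b)"
  have "ereal (- j) \<le> ereal (?I / (2 * pi))"
  proof -
    have "(LINT t:{0..2*pi}|lborel. - j) \<le> ?I"
    proof (rule set_integral_mono[OF _ int])
      fix t show "- j \<le> cutoff \<phi> j (a + cis t *s b)"
        using fin[OF disc[of "cis t"]] by (simp add: cutoff_ge)
    qed (auto simp: set_integrable_def)
    also have "(LINT t:{0..2*pi}|lborel. - j) = 2 * pi * (- j)"
      by (simp add: set_lebesgue_integral_def)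
    finally show ?thesis by (simp add: field_simps)
  qed
  moreover have "\<phi> a \<le> ereal (?I / (2 * pi))"
  proof -
    have "\<phi> a \<le> circle_mean \<phi> a b" using psh disc by (auto simp: psh_on_def)
    also have "\<dots> \<le> circle_mean (\<lambda>z. ereal (cutoff \<phi> j z)) a b"
      using fin[OF disc] by (intro circle_mean_mono) (simp add: ereal_cutoff)
    also have "\<dots> = ereal (?I / (2 * pi))" by (rule circle_mean_real[OF int])
    finally show ?thesis .
  qed
  ultimately have "ereal (cutoff \<phi> j a) \<le> ereal (?I / (2 * pi))"
    using ereal_cutoff[of \<phi> a j, OF fin[OF aU]] by simp
  then show ?thesis by (simp add: field_simps)
qed

lemma continuous_on_ln_max_cmod:
  assumes "continuous_on U F" "0 < d"
  shows "continuous_on U (\<lambda>z. ln (max (cmod (F z)) d))"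
  using assms by (intro continuous_intros) (auto simp: max_def)

text \<open>This is the weight to which the Ohsawa--Takegoshi theorem is applied. The truncations at
  \<open>- j\<close> and \<open>d\<close> keep both summands real and integrable on circles, so
  their mean value inequalities may be added.\<close>

lemma psh_on_cutoff_add_ln:
  assumes psh: "psh_on U \<phi>" and F: "holo_n F U" and d: "0 < d" and k: "0 \<le> k"
  shows "psh_on U (\<lambda>z. ereal (cutoff \<phi> j z + k * ln (max (cmod (F z)) d)))"
proof -
  let ?w = "\<lambda>z. ln (max (cmod (F z)) d)"
  let ?u = "\<lambda>z. cutoff \<phi> j z + k * ?w z"
  have U: "open U" and fin: "\<And>z. z \<in> U \<Longrightarrow> \<phi> z \<noteq> \<infinity>" using psh by (auto simp: psh_on_def)
  have w: "continuous_on U ?w"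
    using continuous_on_ln_max_cmod[OF holo_n_imp_continuous_on[OF F] d] .
  have usc: "usc_on U ?u"
    by (intro usc_on_add_continuous usc_on_cutoff[OF psh] continuous_intros w)
  have o: "open {z\<in>U. ereal (?u z) < c}" for c
    using usc U by (cases c) (auto simp: usc_on_def)
  have "ereal (?u a) \<le> circle_mean (\<lambda>z. ereal (?u z)) a b"
    if disc: "\<And>\<zeta>. cmod \<zeta> \<le> 1 \<Longrightarrow> a + \<zeta> *s b \<in> U" for a b
  proof -
    have int1: "set_integrable lborel {0..2*pi} (\<lambda>t. cutoff \<phi> j (a + cis t *s b))"
      by (rule usc_on_circle_integrable[OF usc_on_cutoff[OF psh] cutoff_ge disc]) (use fin in auto)
    have cw: "continuous_on {0..2*pi} (\<lambda>t. ?w (a + cis t *s b))"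
      by (rule continuous_on_compose2[OF w]) (use disc in \<open>auto intro!: continuous_intros\<close>)
    have int2: "set_integrable lborel {0..2*pi} (\<lambda>t. ?w (a + cis t *s b))"
      using borel_integrable_compact[OF compact_Icc cw] by (simp add: set_integrable_def indicator_scaleR_eq_if)
    \<comment> \<open>Jensen's inequality on the complex line through \<open>a\<close> in the
      direction \<open>b\<close>.\<close>
    have "2 * pi * ?w a \<le> integral {0..2*pi} (\<lambda>t. ?w (a + cis t *s b))"
      using ln_max_cmod_le_circle_mean[OF holo_n_line[OF F, of a b] open_line_vimage[OF U] _ d]
      by (simp add: subset_iff disc)
    also have "\<dots> = (LINT t:{0..2*pi}|lborel. ?w (a + cis t *s b))"
      using set_borel_integral_eq_integral(2)[OF int2] by simp
    finally have "2 * pi * (k * ?w a) \<le> k * (LINT t:{0..2*pi}|lborel. ?w (a + cis t *s b))"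
      using k mult_left_mono by (metis mult.left_commute)
    moreover have "(LINT t:{0..2*pi}|lborel. ?u (a + cis t *s b)) =
       (LINT t:{0..2*pi}|lborel. cutoff \<phi> j (a + cis t *s b)) + k * (LINT t:{0..2*pi}|lborel. ?w (a + cis t *s b))"
      using int1 int2 by (simp add: set_integral_add)
    ultimately have "2 * pi * ?u a \<le> (LINT t:{0..2*pi}|lborel. ?u (a + cis t *s b))"
      using cutoff_le_circle_mean[OF psh disc, where j=j] by (simp add: distrib_left)
    moreover have "set_integrable lborel {0..2*pi} (\<lambda>t. ?u (a + cis t *s b))"
      using int1 int2 by (intro set_integral_add) auto
    ultimately show ?thesis by (simp add: circle_mean_real field_simps)
  qed
  with U o show ?thesis unfolding psh_on_def by (simp add: openin_open_eq)
qed

section \<open>Almost optimal extensions on smaller balls\<close>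

lemma psh_on_subset:
  assumes "psh_on U \<phi>" "open W" "W \<subseteq> U" shows "psh_on W \<phi>"
proof -
  have "open U" "\<And>c. openin (top_of_set U) {z\<in>U. \<phi> z < c}" using assms by (auto simp: psh_on_def)
  then have "open {z\<in>U. \<phi> z < c}" for c using openin_open_eq by blast
  then have "open (W \<inter> {z\<in>U. \<phi> z < c})" for c using assms(2) by (intro open_Int)
  moreover have "W \<inter> {z\<in>U. \<phi> z < c} = {z\<in>W. \<phi> z < c}" for c using assms by auto
  ultimately have "open {z\<in>W. \<phi> z < c}" for c by simp
  with assms show ?thesis unfolding psh_on_def by (simp add: openin_open_eq subset_iff)
qed

lemma holo_on_subvariety_subset:
  assumes f: "holo_on_subvariety f V" and W: "W \<subseteq> V"
  shows "holo_on_subvariety f W"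
  unfolding holo_on_subvariety_def
proof
  fix p assume "p \<in> W"
  with W have "p \<in> V" by blast
  from bspec[OF f[unfolded holo_on_subvariety_def] this] obtain U G
    where "open U \<and> p \<in> U \<and> holo_n G U \<and> (\<forall>z\<in>U \<inter> V. G z = f z)" by (elim exE)
  then show "\<exists>U G. open U \<and> p \<in> U \<and> holo_n G U \<and> (\<forall>z\<in>U \<inter> W. G z = f z)"
    using W by (intro exI[of _ U] exI[of _ G]) auto
qed

text \<open>Near each point of \<open>V\<close>, \<open>f\<close> is the restriction to
  \<open>V\<close> of a holomorphic, hence continuous, function.\<close>

lemma holo_on_subvariety_imp_continuous_on:
  assumes "holo_on_subvariety f V" shows "continuous_on V f"
  unfolding continuous_on_eq_continuous_within
proof
  fix p assume "p \<in> V"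
  from bspec[OF assms[unfolded holo_on_subvariety_def] this] obtain U G
    where UG: "open U \<and> p \<in> U \<and> holo_n G U \<and> (\<forall>z\<in>U \<inter> V. G z = f z)" by (elim exE)
  then have U: "open U" "p \<in> U" "holo_n G U" "\<And>z. z \<in> U \<inter> V \<Longrightarrow> G z = f z" by simp_all
  have "continuous (at p) G"
    using holo_n_imp_continuous_on[OF U(3)] U(1,2) by (simp add: continuous_on_eq_continuous_at)
  then have "continuous (at p within V) G" by (rule continuous_at_imp_continuous_within)
  moreover have "eventually (\<lambda>z. G z = f z) (at p within V)"
    unfolding eventually_at_topological using U(1,2,4) by auto
  moreover have "G p = f p" using U(2,4) \<open>p \<in> V\<close> by blast
  ultimately show "continuous (at p within V) f"
    unfolding continuous_within by (simp add: Lim_transform_eventually[of G])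
qed

lemma zero_set_mono: "s \<le> r \<Longrightarrow> zero_set c s h \<subseteq> zero_set c r h"
  by (auto simp: zero_set_def)

text \<open>For \<open>s < r\<close> the zeros of \<open>h\<close> in the closed ball of radius
  \<open>s\<close> form a compact subset of the larger zero set, where \<open>f\<close> is
  continuous. The bound \<open>d\<close> starts the iteration from the zero function.\<close>

lemma bounded_on_smaller_zero_set:
  assumes h: "holo_n h (ball c r)" and f: "holo_on_subvariety f (zero_set c r h)" and "s < r"
  obtains d where "d > 0" "\<And>z. z \<in> zero_set c s h \<Longrightarrow> cmod (f z) \<le> d"
proof -
  have "continuous_on (cball c s) h"
    using holo_n_imp_continuous_on[OF h] \<open>s < r\<close> by (auto intro: continuous_on_subset)
  then have "closed {z\<in>cball c s. h z = 0}"
    by (rule continuous_closed_preimage_constant) simp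
  moreover have "bounded {z\<in>cball c s. h z = 0}" by (rule bounded_subset[OF bounded_cball]) auto
  ultimately have "compact {z\<in>cball c s. h z = 0}" by (simp add: compact_eq_bounded_closed)
  moreover have "{z\<in>cball c s. h z = 0} \<subseteq> zero_set c r h" using \<open>s < r\<close> by (auto simp: zero_set_def)
  ultimately have "bounded (f ` {z\<in>cball c s. h z = 0})"
    by (intro compact_imp_bounded compact_continuous_image continuous_on_subset[OF holo_on_subvariety_imp_continuous_on[OF f]])
  then obtain d where "d > 0" "\<And>z. z \<in> {z\<in>cball c s. h z = 0} \<Longrightarrow> cmod (f z) \<le> d"
    unfolding bounded_pos by blast
  then show thesis by (intro that[of d]) (auto simp: zero_set_def)
qed

text \<open>With p = \<open>2 / real m\<close>, split \<open>x^2\<close> into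
  \<open>x powr p\<close> times \<open>x powr (2 - p)\<close>. The second factor is at most
  \<open>M powr (2 - p)\<close>, as the exponent is nonnegative, and the exponential cancels that
  bound.\<close>

lemma square_weight_le:
  fixes x M :: real
  assumes "0 \<le> x" "x \<le> M" "0 < M" "1 \<le> m"
  shows "x\<^sup>2 * exp (- ((2 - 2 / real m) * ln M)) \<le> x powr (2 / real m)"
proof (cases "x = 0")
  case False
  with assms have x: "x > 0" by simp
  have k: "0 \<le> 2 - 2 / real m" using assms(4) by (simp add: field_simps)
  have "x\<^sup>2 = x powr (2 / real m) * x powr (2 - 2 / real m)"
    using x by (simp flip: powr_add powr_numeral)
  also have "\<dots> \<le> x powr (2 / real m) * M powr (2 - 2 / real m)"
    using assms k by (intro mult_left_mono powr_mono2) auto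
  also have "M powr (2 - 2 / real m) = exp ((2 - 2 / real m) * ln M)"
    using assms by (simp add: powr_def)
  finally show ?thesis by (simp add: exp_minus pos_divide_le_eq flip: divide_inverse)
qed (use assms in auto)

text \<open>Young's inequality with weights \<open>1 / real m\<close> and
  \<open>1 - 1 / real m\<close>. In the corresponding weighted geometric mean the powers of
  \<open>M\<close> cancel, which leaves \<open>x powr (2 / real m)\<close>.\<close>

lemma young_weight:
  fixes x M :: real
  assumes "0 \<le> x" "0 < M" "1 \<le> m"
  shows "x powr (2 / real m) \<le> (1 / real m) * (x\<^sup>2 * exp (- ((2 - 2 / real m) * ln M)))
           + (1 - 1 / real m) * M powr (2 / real m)"
proof (cases "x = 0")
  case True
  then show ?thesis using assms by (simp add: field_simps)
next
  case False
  with assms have x: "x > 0" by simp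
  let ?a = "x\<^sup>2 * exp (- ((2 - 2 / real m) * ln M))" and ?b = "M powr (2 / real m)"
  have a: "?a = exp (2 * ln x - (2 - 2 / real m) * ln M)"
  proof -
    have "x\<^sup>2 = exp (2 * ln x)" using x by (simp add: powr_def flip: powr_numeral)
    then show ?thesis by (simp only: flip: exp_add) simp
  qed
  have "?a powr (1 / real m) * ?b powr (1 - 1 / real m) =
      exp ((1 / real m) * (2 * ln x - (2 - 2 / real m) * ln M) + (1 - 1 / real m) * ((2 / real m) * ln M))"
    unfolding a using assms by (simp add: powr_def exp_add mult.commute)
  also have "(1 / real m) * (2 * ln x - (2 - 2 / real m) * ln M) + (1 - 1 / real m) * ((2 / real m) * ln M)
      = (2 / real m) * ln x" using assms(3) by (simp add: field_simps)
  also have "exp \<dots> = x powr (2 / real m)" using x by (simp add: powr_def)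
  finally have "x powr (2 / real m) = ?a powr (1 / real m) * ?b powr (1 - 1 / real m)" by simp
  also have "\<dots> \<le> (1 / real m) * ?a + (1 - 1 / real m) * ?b"
    using assms x by (intro Youngs_inequality_0) auto
  finally show ?thesis .
qed

lemma max_powr_le_add:
  fixes x d :: real
  assumes "0 \<le> x" "0 \<le> d"
  shows "(max x d) powr p \<le> x powr p + d powr p"
  using assms by (auto simp: max_def)

section \<open>Applying the extension theorem with the modified weight\<close>

lemma ot_data_imp_usc_cutoff:
  assumes "ot_data c r h \<phi>" "s \<le> r"
  shows "usc_on (ball c s) (cutoff \<phi> j)" "z \<in> ball c s \<Longrightarrow> \<phi> z \<noteq> \<infinity>"
proof -
  have "psh_on (ball c s) \<phi>"
    by (rule psh_on_subset[of "ball c r"]) (use assms in \<open>simp_all add: ot_data_def subset_ball\<close>)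
  then show "usc_on (ball c s) (cutoff \<phi> j)" "z \<in> ball c s \<Longrightarrow> \<phi> z \<noteq> \<infinity>"
    using usc_on_cutoff by (blast, simp add: psh_on_def)
qed

text \<open>On the zero set the logarithmic term turns \<open>|f|^2\<close> into at most
  \<open>|f|^(2/m)\<close>, by the hypothesis on \<open>max (cmod (G z)) d\<close>. The resulting
  bound does not depend on \<open>G\<close>, \<open>d\<close>, \<open>s\<close> or \<open>j\<close>.
  Two choices matter later: \<open>G\<close> an extension of \<open>f\<close>, and
  \<open>G = 0\<close> with \<open>d\<close> a bound for \<open>|f|\<close>.\<close>

lemma OT_with_weight:
  fixes c :: "complex^'n" and C0 :: real
  assumes OT: "OT_holds TYPE('n) C0" and data: "ot_data c r h \<phi>" and m: "1 \<le> m"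
    and hf: "holo_on_subvariety f (zero_set c r h)"
    and s: "s \<le> r" "zero_set c s h \<noteq> {}"
    and G: "holo_n G (ball c s)" and d: "0 < d"
    and le: "\<And>z. z \<in> zero_set c s h \<Longrightarrow> cmod (f z) \<le> max (cmod (G z)) d"
  obtains F where "holo_n F (ball c s)" "\<And>z. z \<in> zero_set c s h \<Longrightarrow> F z = f z"
    "(\<integral>\<^sup>+ z\<in>ball c s. ennreal ((cmod (F z))\<^sup>2 * exp (- (cutoff \<phi> j z + (2 - 2 / real m) * ln (max (cmod (G z)) d)))) \<partial>lborel)
      \<le> ennreal C0 * (\<integral>\<^sup>+ z\<in>zero_set c r h. ennreal ((cmod (f z)) powr (2 / real m)) * exp_neg (\<phi> z)
             / ennreal (dh_norm_sq h z) \<partial>hausdorff_measure (2 * CARD('n) - 2))"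
proof -
  let ?k = "2 - 2 / real m"
  let ?\<psi> = "\<lambda>z. cutoff \<phi> j z + ?k * ln (max (cmod (G z)) d)"
  have sub: "ball c s \<subseteq> ball c r" using s by auto
  have psh: "psh_on (ball c s) \<phi>"
    by (rule psh_on_subset[of "ball c r"]) (use data sub in \<open>simp_all add: ot_data_def\<close>)
  have fin: "\<And>z. z \<in> ball c s \<Longrightarrow> \<phi> z \<noteq> \<infinity>" using psh by (auto simp: psh_on_def)
  have k: "0 \<le> ?k" using m by (simp add: field_simps)
  have "0 < s"
  proof -
    obtain z where "dist c z < s" using s(2) by (auto simp: zero_set_def)
    then show ?thesis using zero_le_dist[of c z] by linarith
  qed
  \<comment> \<open>The new weight is real-valued, so any zero of \<open>h\<close> in the smaller
    ball is a point where it differs from \<open>-\<infinity>\<close>.\<close>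
  then have "ot_data c s h (\<lambda>z. ereal (?\<psi> z))"
    using data sub s(2) psh_on_cutoff_add_ln[OF psh G d k] holo_n_subset[of h "ball c r" "ball c s"]
    unfolding ot_data_def zero_set_def by auto
  moreover have "holo_on_subvariety f (zero_set c s h)"
    using hf holo_on_subvariety_subset zero_set_mono[OF s(1)] by blast
  ultimately obtain F where F: "holo_n F (ball c s)" "\<forall>z\<in>zero_set c s h. F z = f z"
    "(\<integral>\<^sup>+ z\<in>ball c s. ennreal ((cmod (F z))^2) * exp_neg (ereal (?\<psi> z)) \<partial>lborel)
          \<le> ennreal C0 * (\<integral>\<^sup>+ z\<in>zero_set c s h. ennreal ((cmod (f z))^2) * exp_neg (ereal (?\<psi> z))
                 / ennreal (dh_norm_sq h z) \<partial>hausdorff_measure (2 * CARD('n) - 2))"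
    using OT unfolding OT_holds_def by blast
  have pw: "ennreal ((cmod (f z))^2) * exp_neg (ereal (?\<psi> z)) \<le> ennreal ((cmod (f z)) powr (2 / real m)) * exp_neg (\<phi> z)"
    if z: "z \<in> zero_set c s h" for z
  proof -
    have zb: "z \<in> ball c s" using z by (simp add: zero_set_def)
    have "(cmod (f z))\<^sup>2 * exp (- ?\<psi> z) = (cmod (f z))\<^sup>2 * exp (- (?k * ln (max (cmod (G z)) d))) * exp (- cutoff \<phi> j z)"
      by (simp flip: exp_add)
    also have "\<dots> \<le> (cmod (f z)) powr (2 / real m) * exp (- cutoff \<phi> j z)"
      using le[OF z] d m by (intro mult_right_mono square_weight_le) auto
    finally have "ennreal ((cmod (f z))^2) * exp_neg (ereal (?\<psi> z)) \<le> ennreal ((cmod (f z)) powr (2 / real m)) * ennreal (exp (- cutoff \<phi> j z))"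
      by (simp add: exp_neg_def flip: ennreal_mult del: minus_add_distrib)
    also have "\<dots> \<le> ennreal ((cmod (f z)) powr (2 / real m)) * exp_neg (\<phi> z)"
      by (intro mult_left_mono exp_cutoff_le_exp_neg fin[OF zb]) auto
    finally show ?thesis .
  qed
  have "(\<integral>\<^sup>+ z\<in>zero_set c s h. ennreal ((cmod (f z))^2) * exp_neg (ereal (?\<psi> z))
                 / ennreal (dh_norm_sq h z) \<partial>hausdorff_measure (2 * CARD('n) - 2))
      \<le> (\<integral>\<^sup>+ z\<in>zero_set c r h. ennreal ((cmod (f z)) powr (2 / real m)) * exp_neg (\<phi> z)
             / ennreal (dh_norm_sq h z) \<partial>hausdorff_measure (2 * CARD('n) - 2))"
    using zero_set_mono[OF s(1), of c h]
    by (intro nn_integral_mono) (auto split: split_indicator intro!: divide_right_mono_ennreal pw)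
  then have "ennreal C0 * (\<integral>\<^sup>+ z\<in>zero_set c s h. ennreal ((cmod (f z))^2) * exp_neg (ereal (?\<psi> z))
                 / ennreal (dh_norm_sq h z) \<partial>hausdorff_measure (2 * CARD('n) - 2))
      \<le> ennreal C0 * (\<integral>\<^sup>+ z\<in>zero_set c r h. ennreal ((cmod (f z)) powr (2 / real m)) * exp_neg (\<phi> z)
             / ennreal (dh_norm_sq h z) \<partial>hausdorff_measure (2 * CARD('n) - 2))"
    by (rule mult_left_mono) auto
  with F(3) have "(\<integral>\<^sup>+ z\<in>ball c s. ennreal ((cmod (F z))^2) * exp_neg (ereal (?\<psi> z)) \<partial>lborel) \<le> \<dots>"
    by (rule order_trans)
  moreover have "ennreal ((cmod (F z))^2) * exp_neg (ereal (?\<psi> z)) = ennreal ((cmod (F z))^2 * exp (- ?\<psi> z))" for z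
    by (simp add: exp_neg_def ennreal_mult)
  ultimately show thesis using F(1,2) that by simp
qed

section \<open>Integrated inequalities and the infimum over all extensions\<close>

lemma borel_measurable_restrict_lborel_continuous:
  "continuous_on U f \<Longrightarrow> f \<in> borel_measurable (restrict_space lborel U)"
  unfolding measurable_cong_sets[OF sets_restrict_space_cong[OF sets_lborel] refl]
  by (rule borel_measurable_continuous_on_restrict)

lemma borel_measurable_restrict_lborel_usc:
  "usc_on U f \<Longrightarrow> f \<in> borel_measurable (restrict_space lborel U)"
  unfolding measurable_cong_sets[OF sets_restrict_space_cong[OF sets_lborel] refl]
  by (rule usc_on_measurable)

text \<open>\<open>young_weight\<close> multiplied by \<open>exp (- q z)\<close> and integrated. The
  first integral on the right is the one that \<open>OT_with_weight\<close> bounds.\<close>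

lemma young_integral:
  fixes F G :: "complex^'n \<Rightarrow> complex"
  assumes F: "continuous_on (ball c s) F" and G: "continuous_on (ball c s) G" and q: "usc_on (ball c s) q"
    and d: "0 < d" and m: "1 \<le> m"
  shows "(\<integral>\<^sup>+ z\<in>ball c s. ennreal (cmod (F z) powr (2 / real m) * exp (- q z)) \<partial>lborel) \<le>
     ennreal (1 / real m) * (\<integral>\<^sup>+ z\<in>ball c s. ennreal ((cmod (F z))\<^sup>2 * exp (- (q z + (2 - 2 / real m) * ln (max (cmod (G z)) d)))) \<partial>lborel)
   + ennreal (1 - 1 / real m) * (\<integral>\<^sup>+ z\<in>ball c s. ennreal (max (cmod (G z)) d powr (2 / real m) * exp (- q z)) \<partial>lborel)"
proof -
  \<comment> \<open>The functions are controlled on the ball only, hence measurability in the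
    restricted space.\<close>
  let ?N = "restrict_space lborel (ball c s)"
  have [measurable]: "F \<in> borel_measurable ?N" "G \<in> borel_measurable ?N" "q \<in> borel_measurable ?N"
    using F G q by (auto intro: borel_measurable_restrict_lborel_continuous borel_measurable_restrict_lborel_usc)
  have m': "0 \<le> 1 - 1 / real m" using m by (simp add: field_simps)
  have pw: "cmod (F z) powr (2 / real m) * exp (- q z) \<le>
      (1 / real m) * ((cmod (F z))\<^sup>2 * exp (- (q z + (2 - 2 / real m) * ln (max (cmod (G z)) d))))
     + (1 - 1 / real m) * (max (cmod (G z)) d powr (2 / real m) * exp (- q z))" (is "?l \<le> ?r") for z
  proof -
    have "?l \<le> ((1 / real m) * ((cmod (F z))\<^sup>2 * exp (- ((2 - 2 / real m) * ln (max (cmod (G z)) d))))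
           + (1 - 1 / real m) * max (cmod (G z)) d powr (2 / real m)) * exp (- q z)"
      using d m by (intro mult_right_mono young_weight) auto
    also have "\<dots> = ?r" by (simp add: exp_add exp_diff exp_minus field_simps)
    finally show ?thesis .
  qed
  have "(\<integral>\<^sup>+ z. ennreal (cmod (F z) powr (2 / real m) * exp (- q z)) \<partial>?N) \<le>
     (\<integral>\<^sup>+ z. ennreal (1 / real m) * ennreal ((cmod (F z))\<^sup>2 * exp (- (q z + (2 - 2 / real m) * ln (max (cmod (G z)) d))))
       + ennreal (1 - 1 / real m) * ennreal (max (cmod (G z)) d powr (2 / real m) * exp (- q z)) \<partial>?N)"
    using pw m' by (intro nn_integral_mono) (simp flip: ennreal_mult' ennreal_plus)
  also have "\<dots> = ennreal (1 / real m) * (\<integral>\<^sup>+ z. ennreal ((cmod (F z))\<^sup>2 * exp (- (q z + (2 - 2 / real m) * ln (max (cmod (G z)) d)))) \<partial>?N)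
   + ennreal (1 - 1 / real m) * (\<integral>\<^sup>+ z. ennreal (max (cmod (G z)) d powr (2 / real m) * exp (- q z)) \<partial>?N)"
    by (subst nn_integral_add) (auto simp: nn_integral_cmult)
  finally show ?thesis by (simp add: nn_integral_restrict_space)
qed

text \<open>Replacing \<open>|G|\<close> by \<open>max |G| d\<close> costs at most the integral of
  \<open>d powr p * exp j\<close> over the ball, since \<open>q\<close> is at least
  \<open>- j\<close>. For fixed \<open>j\<close> and positive \<open>p\<close> this tends to 0 with
  \<open>d\<close>; the weight is truncated to make this work.\<close>

lemma integral_max_weight_le:
  fixes G :: "complex^'n \<Rightarrow> complex"
  assumes G: "continuous_on (ball c s) G" and q: "usc_on (ball c s) q" "\<And>z. z \<in> ball c s \<Longrightarrow> - j \<le> q z"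
    and d: "0 < d"
  shows "(\<integral>\<^sup>+ z\<in>ball c s. ennreal (max (cmod (G z)) d powr p * exp (- q z)) \<partial>lborel)
    \<le> (\<integral>\<^sup>+ z\<in>ball c s. ennreal (cmod (G z) powr p * exp (- q z)) \<partial>lborel)
      + ennreal (d powr p * exp j * measure lborel (ball c s))"
proof -
  let ?N = "restrict_space lborel (ball c s)"
  have [measurable]: "G \<in> borel_measurable ?N" "q \<in> borel_measurable ?N"
    using G q by (auto intro: borel_measurable_restrict_lborel_continuous borel_measurable_restrict_lborel_usc)
  have "(\<integral>\<^sup>+ z. ennreal (max (cmod (G z)) d powr p * exp (- q z)) \<partial>?N) \<le>
     (\<integral>\<^sup>+ z. ennreal (cmod (G z) powr p * exp (- q z)) + ennreal (d powr p * exp j) \<partial>?N)"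
  proof (intro nn_integral_mono)
    fix z assume "z \<in> space ?N"
    then have z: "z \<in> ball c s" by (simp add: space_restrict_space)
    have "max (cmod (G z)) d powr p * exp (- q z) \<le> (cmod (G z) powr p + d powr p) * exp (- q z)"
      using d by (intro mult_right_mono max_powr_le_add) auto
    also have "\<dots> \<le> cmod (G z) powr p * exp (- q z) + d powr p * exp j"
      using q(2)[OF z] by (simp add: distrib_right mult_left_mono)
    finally show "ennreal (max (cmod (G z)) d powr p * exp (- q z)) \<le> ennreal (cmod (G z) powr p * exp (- q z)) + ennreal (d powr p * exp j)"
      by (simp flip: ennreal_plus)
  qed
  also have "\<dots> = (\<integral>\<^sup>+ z. ennreal (cmod (G z) powr p * exp (- q z)) \<partial>?N) + ennreal (d powr p * exp j) * emeasure ?N (space ?N)"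
    by (subst nn_integral_add) auto
  also have "emeasure ?N (space ?N) = ennreal (measure lborel (ball c s))"
    using emeasure_lborel_ball_finite[of c s]
    by (simp add: emeasure_restrict_space space_restrict_space emeasure_eq_ennreal_measure[of lborel])
  finally show ?thesis by (simp add: nn_integral_restrict_space ennreal_mult')
qed

text \<open>Improving a nearly optimal extension shows that the infimum of the weighted integrals is
  at most \<open>K\<close>. The slack \<open>e\<close> allows for an infimum that is not
  attained.\<close>

lemma almost_optimal_extension:
  fixes c :: "complex^'n" and C0 :: real
  assumes OT: "OT_holds TYPE('n) C0" and data: "ot_data c r h \<phi>" and m: "1 \<le> m"
    and hf: "holo_on_subvariety f (zero_set c r h)"
    and s: "s < r" "zero_set c s h \<noteq> {}" and e: "0 < e"
    and K: "K = ennreal C0 * (\<integral>\<^sup>+ z\<in>zero_set c r h. ennreal ((cmod (f z)) powr (2 / real m)) * exp_neg (\<phi> z)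
             / ennreal (dh_norm_sq h z) \<partial>hausdorff_measure (2 * CARD('n) - 2))" "K < \<infinity>"
  obtains F where "holo_n F (ball c s)" "\<And>z. z \<in> zero_set c s h \<Longrightarrow> F z = f z"
    "(\<integral>\<^sup>+ z\<in>ball c s. ennreal (cmod (F z) powr (2 / real m) * exp (- cutoff \<phi> j z)) \<partial>lborel) \<le> K + ennreal e"
proof -
  define p where "p = 2 / real m"
  have p: "p > 0" using m by (simp add: p_def)
  define J where "J F = (\<integral>\<^sup>+ z\<in>ball c s. ennreal (cmod (F z) powr p * exp (- cutoff \<phi> j z)) \<partial>lborel)" for F
  define E where "E = {F. holo_n F (ball c s) \<and> (\<forall>z\<in>zero_set c s h. F z = f z)}"
  define A where "A = (INF F\<in>E. J F)"
  define v where "v = exp j * measure lborel (ball c s)"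
  have v: "v \<ge> 0" by (simp add: v_def)
  have sr: "s \<le> r" using s by simp
  note q = ot_data_imp_usc_cutoff[OF data sr]
  \<comment> \<open>One improvement step: \<open>OT_with_weight\<close> replaces \<open>G\<close> by
    a new extension, \<open>young_integral\<close> compares the two integrals, and truncating
    \<open>|G|\<close> at \<open>d\<close> adds \<open>d powr p * v\<close>.\<close>
  have step: "A \<le> ennreal (1 / real m) * K + ennreal (1 - 1 / real m) * (J G + ennreal (d powr p * v))"
    if G: "holo_n G (ball c s)" and d: "d > 0"
      and le: "\<And>z. z \<in> zero_set c s h \<Longrightarrow> cmod (f z) \<le> max (cmod (G z)) d" for G d
  proof -
    obtain F where F: "holo_n F (ball c s)" "\<And>z. z \<in> zero_set c s h \<Longrightarrow> F z = f z"
      "(\<integral>\<^sup>+ z\<in>ball c s. ennreal ((cmod (F z))\<^sup>2 * exp (- (cutoff \<phi> j z + (2 - 2 / real m) * ln (max (cmod (G z)) d)))) \<partial>lborel) \<le> K"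
      using OT_with_weight[OF OT data m hf sr s(2) G d le, of j] unfolding K(1) by blast
    have "A \<le> J F" unfolding A_def by (rule INF_lower) (use F in \<open>auto simp: E_def\<close>)
    also have "\<dots> \<le> ennreal (1 / real m) * (\<integral>\<^sup>+ z\<in>ball c s. ennreal ((cmod (F z))\<^sup>2 * exp (- (cutoff \<phi> j z + (2 - 2 / real m) * ln (max (cmod (G z)) d)))) \<partial>lborel)
   + ennreal (1 - 1 / real m) * (\<integral>\<^sup>+ z\<in>ball c s. ennreal (max (cmod (G z)) d powr p * exp (- cutoff \<phi> j z)) \<partial>lborel)"
      unfolding J_def p_def
      by (intro young_integral holo_n_imp_continuous_on F(1) G q d m)
    also have "\<dots> \<le> ennreal (1 / real m) * K + ennreal (1 - 1 / real m) * (J G + ennreal (d powr p * v))"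
      unfolding J_def v_def mult.assoc[symmetric]
      by (intro add_mono mult_left_mono F(3) integral_max_weight_le holo_n_imp_continuous_on G q d cutoff_ge) auto
    finally show ?thesis .
  qed
  obtain d where d: "d > 0" "\<And>z. z \<in> zero_set c s h \<Longrightarrow> cmod (f z) \<le> d"
    using bounded_on_smaller_zero_set[OF _ hf s(1)] data by (auto simp: ot_data_def)
  have "J (\<lambda>_. 0) = 0" by (simp add: J_def)
  \<comment> \<open>The step for \<open>G = 0\<close> and a bound \<open>d\<close> of
    \<open>|f|\<close> shows that \<open>A\<close> is finite. Otherwise the term with
    \<open>A\<close> on the right could not be absorbed.\<close>
  then have "A \<le> ennreal (1 / real m) * K + ennreal (1 - 1 / real m) * ennreal (d powr p * v)"
    using step[OF holo_n_const[of "ball c s" 0] d(1)] d by (simp add: max_def)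
  also have "\<dots> < \<infinity>" using K(2) by (simp add: ennreal_mult_less_top)
  finally obtain \<alpha> where \<alpha>: "A = ennreal \<alpha>" "\<alpha> \<ge> 0" by (cases A) auto
  obtain k where k: "K = ennreal k" "k \<ge> 0" using K(2) by (cases K) auto
  have "\<alpha> \<le> k"
  proof (rule field_le_epsilon)
    fix \<epsilon> :: real assume "\<epsilon> > 0"
    define \<theta> where "\<theta> = 1 / real m"
    have \<theta>: "0 < \<theta>" "0 \<le> 1 - \<theta>" using m by (auto simp: \<theta>_def field_simps)
    \<comment> \<open>The errors add up to at most
      \<open>2 * \<delta> = \<epsilon> * \<theta>\<close>, and the final division by
      \<open>\<theta>\<close> leaves \<open>\<epsilon>\<close>.\<close>
    define \<delta> where "\<delta> = \<epsilon> * \<theta> / 2"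
    have \<delta>: "\<delta> > 0" using \<open>\<epsilon> > 0\<close> \<theta> by (simp add: \<delta>_def)
    \<comment> \<open>Chosen so that \<open>d powr p * v\<close> is at most \<open>\<delta>\<close>;
      \<open>v + 1\<close> avoids a division by zero.\<close>
    define d where "d = (\<delta> / (v + 1)) powr (1 / p)"
    have "d > 0" using \<delta> v by (simp add: d_def)
    have "d powr p * v \<le> \<delta>"
    proof -
      have "d powr p = \<delta> / (v + 1)" using p \<delta> v by (simp add: d_def powr_powr)
      moreover have "\<delta> * v \<le> \<delta> * (v + 1)" using \<delta> by simp
      ultimately show ?thesis using v by (simp add: pos_divide_le_eq)
    qed
    have "A < ennreal (\<alpha> + \<delta>)" using \<alpha> \<delta> by (simp add: ennreal_less_iff)
    then obtain G where G: "G \<in> E" "J G < ennreal (\<alpha> + \<delta>)" unfolding A_def by (auto simp: INF_less_iff)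
    \<comment> \<open>As \<open>G\<close> agrees with \<open>f\<close> on the zero set,
      \<open>|f|\<close> is at most \<open>max |G| d\<close> there for every positive
      \<open>d\<close>.\<close>
    have "ennreal \<alpha> \<le> ennreal \<theta> * ennreal k + ennreal (1 - \<theta>) * (J G + ennreal (d powr p * v))"
      using step[of G, OF _ \<open>d > 0\<close>] G(1) \<alpha> k by (auto simp: E_def \<theta>_def)
    also have "\<dots> \<le> ennreal \<theta> * ennreal k + ennreal (1 - \<theta>) * (ennreal (\<alpha> + \<delta>) + ennreal \<delta>)"
      using G(2) \<open>d powr p * v \<le> \<delta>\<close> by (intro add_mono mult_left_mono ennreal_leI) auto
    also have "\<dots> = ennreal (\<theta> * k + (1 - \<theta>) * (\<alpha> + \<delta> + \<delta>))"
      using k(2) \<alpha>(2) \<delta> \<theta> by (simp only: ennreal_mult ennreal_plus mult_nonneg_nonneg add_nonneg_nonneg less_imp_le)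
    finally have "\<alpha> \<le> \<theta> * k + (1 - \<theta>) * (\<alpha> + \<delta> + \<delta>)"
      using k(2) \<alpha>(2) \<delta> \<theta> by (subst (asm) ennreal_le_iff) (auto intro!: add_nonneg_nonneg mult_nonneg_nonneg)
    also have "\<dots> \<le> \<theta> * k + (1 - \<theta>) * \<alpha> + 2 * \<delta>"
      using mult_right_mono[of "1 - \<theta>" 1 "2 * \<delta>"] \<delta> \<theta> by (simp add: algebra_simps)
    finally have "\<theta> * \<alpha> \<le> \<theta> * (k + \<epsilon>)" by (simp add: \<delta>_def algebra_simps)
    then show "\<alpha> \<le> k + \<epsilon>" using \<theta> by simp
  qed
  then have "A < K + ennreal e"
  proof -
    have "ennreal \<alpha> < ennreal (k + e)" using \<open>\<alpha> \<le> k\<close> \<alpha>(2) e by (intro ennreal_lessI) auto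
    then show ?thesis using \<alpha>(1) k e by (simp add: ennreal_plus)
  qed
  then obtain F where "F \<in> E" "J F < K + ennreal e" unfolding A_def by (auto simp: INF_less_iff)
  then show thesis using that[of F] by (auto simp: E_def J_def p_def)
qed

section \<open>The sub-mean value property over balls\<close>

lemma nn_integral_lborel_translate:
  fixes g :: "'a::euclidean_space \<Rightarrow> ennreal"
  assumes [measurable]: "g \<in> borel_measurable borel"
  shows "(\<integral>\<^sup>+ x. g (a + x) \<partial>lborel) = (\<integral>\<^sup>+ x. g x \<partial>lborel)"
proof -
  have "(\<integral>\<^sup>+ x. g x \<partial>lborel) = (\<integral>\<^sup>+ x. g x \<partial>distr lborel borel ((+) a))"
    by (simp add: lborel_distr_plus)
  then show ?thesis by (simp add: nn_integral_distr)
qed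

text \<open>Both sides, multiplied by the volume of the unit ball \<open>B\<close>, are evaluations of
  \<open>\<integral>\<integral> g (T x) 1_B (T x - y) dx dy\<close> in the two orders of integration; this needs only translation
  invariance and \<open>T B = B\<close>.\<close>
lemma nn_integral_orthogonal_transformation:
  fixes T :: "'a::euclidean_space \<Rightarrow> 'a" and g :: "'a \<Rightarrow> ennreal"
  assumes T: "orthogonal_transformation T" and [measurable]: "g \<in> borel_measurable borel"
  shows "(\<integral>\<^sup>+ x. g (T x) \<partial>lborel) = (\<integral>\<^sup>+ x. g x \<partial>lborel)"
proof -
  have lin: "linear T" and nT: "\<And>x. norm (T x) = norm x" and "surj T"
    using T by (auto simp: orthogonal_transformation orthogonal_transformation_surj)
  then obtain S where S: "\<And>y. T (S y) = y" by (metis surj_f_inv_f)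
  have TS: "T (S y + x) = y + T x" for x y using lin S by (simp add: linear_add)
  have [measurable]: "T \<in> borel_measurable borel"
    by (intro borel_measurable_continuous_onI linear_continuous_on) (simp add: lin linear_linear linear_conv_bounded_linear[symmetric])
  let ?B = "indicator (ball 0 1) :: 'a \<Rightarrow> ennreal"
  have [measurable]: "?B \<in> borel_measurable borel" by (rule borel_measurable_indicator) simp
  have B: "?B (T x) = ?B x" "?B (- x) = ?B x" for x by (auto simp: nT split: split_indicator)
  have "(\<integral>\<^sup>+ y. ?B (T x - y) \<partial>lborel) = emeasure lborel (ball 0 1 :: 'a set)" for x
  proof -
    have "(\<integral>\<^sup>+ y. ?B (T x - y) \<partial>lborel) = (\<integral>\<^sup>+ y. ?B (- T x + y) \<partial>lborel)"
      by (intro nn_integral_cong) (metis B(2) minus_diff_eq uminus_add_conv_diff)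
    also have "\<dots> = emeasure lborel (ball 0 1 :: 'a set)" 
      using nn_integral_lborel_translate[of ?B "- T x"] by simp
    finally show ?thesis .
  qed
  \<comment> \<open>For each \<open>x\<close> the indicator of the unit ball, integrated over
    \<open>y\<close>, contributes the volume of that ball.\<close>
  then have "(\<integral>\<^sup>+ x. g (T x) \<partial>lborel) * emeasure lborel (ball 0 1 :: 'a set)
      = (\<integral>\<^sup>+ x. \<integral>\<^sup>+ y. g (T x) * ?B (T x - y) \<partial>lborel \<partial>lborel)"
    by (simp add: nn_integral_multc nn_integral_cmult)
  also have "\<dots> = (\<integral>\<^sup>+ y. \<integral>\<^sup>+ x. g (T x) * ?B (T x - y) \<partial>lborel \<partial>lborel)"
    by (rule lborel_pair.Fubini'[symmetric]) measurable
  also have "\<dots> = (\<integral>\<^sup>+ y. \<integral>\<^sup>+ x. g (y + T x) * ?B x \<partial>lborel \<partial>lborel)"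
  proof (rule nn_integral_cong)
    fix y
    \<comment> \<open>Translation by a preimage \<open>S y\<close> of \<open>y\<close> turns
      \<open>T x - y\<close> into \<open>T x\<close>, which lies in the unit ball exactly when
      \<open>x\<close> does.\<close>
    have "(\<integral>\<^sup>+ x. g (T x) * ?B (T x - y) \<partial>lborel) = (\<integral>\<^sup>+ x. g (T (S y + x)) * ?B (T (S y + x) - y) \<partial>lborel)"
      by (rule nn_integral_lborel_translate[symmetric]) measurable
    then show "(\<integral>\<^sup>+ x. g (T x) * ?B (T x - y) \<partial>lborel) = (\<integral>\<^sup>+ x. g (y + T x) * ?B x \<partial>lborel)"
      by (simp add: TS B)
  qed
  also have "\<dots> = (\<integral>\<^sup>+ x. \<integral>\<^sup>+ y. g (y + T x) * ?B x \<partial>lborel \<partial>lborel)"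
    by (rule lborel_pair.Fubini') measurable
  also have "\<dots> = (\<integral>\<^sup>+ x. (\<integral>\<^sup>+ y. g y \<partial>lborel) * ?B x \<partial>lborel)"
    using nn_integral_lborel_translate[of g] by (simp add: nn_integral_multc add.commute[of _ "T _"])
  also have "\<dots> = (\<integral>\<^sup>+ y. g y \<partial>lborel) * emeasure lborel (ball 0 1 :: 'a set)"
    by (simp add: nn_integral_cmult)
  finally have eq: "(\<integral>\<^sup>+ x. g (T x) \<partial>lborel) * emeasure lborel (ball 0 1 :: 'a set) = \<dots>" .
  \<comment> \<open>The volume of the unit ball can be cancelled because it is neither 0 nor
    infinite.\<close>
  have "emeasure lborel (ball 0 1 :: 'a set) \<noteq> 0" "emeasure lborel (ball 0 1 :: 'a set) \<noteq> top"
    using content_ball_pos[of 1 "0::'a"] emeasure_lborel_ball_finite[of "0::'a" 1]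
    by (auto simp: measure_def)
  with eq show ?thesis by (metis ennreal_mult_le_mult_iff antisym order_refl mult.commute)
qed

section \<open>Averaging over circles and balls\<close>

lemma orthogonal_transformation_cis: "orthogonal_transformation (\<lambda>v::complex^'n. cis t *s v)"
  unfolding orthogonal_transformation
  using bounded_linear.linear[OF bounded_linear_cvector_scalar_mult_right[of "cis t"]]
  by (simp add: norm_cvector_scalar_mult)

text \<open>The mean value inequality for the logarithm passes to the power by convexity of
  \<open>exp\<close>: the graph lies above its tangent at the central value, and the tangent can be
  integrated with Jensen's inequality.\<close>

lemma powr_le_circle_nn_integral:
  fixes F :: "complex^'n \<Rightarrow> complex"
  assumes F: "holo_n F U" and d: "0 < d" and p: "0 \<le> p" and disc: "\<And>\<zeta>. cmod \<zeta> \<le> 1 \<Longrightarrow> a + \<zeta> *s b \<in> U"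
  shows "ennreal (max (cmod (F a)) d powr p) * ennreal (2 * pi)
     \<le> (\<integral>\<^sup>+ t. ennreal (max (cmod (F (a + cis t *s b))) d powr p) * indicator {0..2*pi} t \<partial>lborel)"
proof -
  let ?w = "\<lambda>z. ln (max (cmod (F z)) d)"
  let ?g = "\<lambda>t. max (cmod (F (a + cis t *s b))) d powr p"
  have pos: "max (cmod (F z)) d > 0" for z using d by simp
  have pw: "max (cmod (F z)) d powr p = exp (p * ?w z)" for z
    using pos[of z] by (simp add: powr_def del: max_less_iff_conj less_max_iff_disj)
  have cF: "continuous_on {0..2*pi} (\<lambda>t. F (a + cis t *s b))"
    by (rule continuous_on_compose2[OF holo_n_imp_continuous_on[OF F]])
       (use disc in \<open>auto intro!: continuous_intros\<close>)
  have cw: "continuous_on {0..2*pi} (\<lambda>t. ?w (a + cis t *s b))"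
    by (rule continuous_on_ln_max_cmod[OF cF d])
  have cg: "continuous_on {0..2*pi} ?g"
    unfolding pw by (intro continuous_intros cw)
  let ?m = "p * ?w a"
  have mean: "exp ?m * (2 * pi) \<le> integral {0..2*pi} ?g"
  proof -
    \<comment> \<open>The integrand is the tangent to \<open>exp\<close> at \<open>?m\<close>,
      evaluated at \<open>p * ?w\<close> along the circle.\<close>
    have lin: "integral {0..2*pi} (\<lambda>t. exp ?m * (1 + p * ?w (a + cis t *s b) - ?m))
       = exp ?m * (2 * pi + p * integral {0..2*pi} (\<lambda>t. ?w (a + cis t *s b)) - 2 * pi * ?m)"
    proof -
      have "((\<lambda>t. exp ?m * (1 + p * ?w (a + cis t *s b) - ?m)) has_integral
        exp ?m * (2 * pi * 1 + p * integral {0..2*pi} (\<lambda>t. ?w (a + cis t *s b)) - 2 * pi * ?m)) {0..2*pi}"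
        using integrable_integral[OF integrable_continuous_real[OF cw]]
          has_integral_const_real[of "1::real" 0 "2*pi"] has_integral_const_real[of ?m 0 "2*pi"]
        by (intro has_integral_mult_right has_integral_diff has_integral_add) auto
      then show ?thesis by (simp only: integral_unique mult_1_right)
    qed
    have "2 * pi * ?w a \<le> integral {0..2*pi} (\<lambda>t. ?w (a + cis t *s b))"
      using ln_max_cmod_le_circle_mean[OF holo_n_line[OF F, of a b] open_line_vimage _ d] F
      by (simp add: subset_iff disc holo_n_def)
    then have "2 * pi * ?m \<le> p * integral {0..2*pi} (\<lambda>t. ?w (a + cis t *s b))"
      using p mult_left_mono by (metis mult.left_commute)
    then have "exp ?m * (2 * pi) \<le> integral {0..2*pi} (\<lambda>t. exp ?m * (1 + p * ?w (a + cis t *s b) - ?m))"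
      unfolding lin by (intro mult_left_mono) auto
    also have "\<dots> \<le> integral {0..2*pi} ?g"
    proof (rule integral_le)
      show "exp ?m * (1 + p * ?w (a + cis t *s b) - ?m) \<le> ?g t" for t
      proof -
        have "exp ?m * (1 + (p * ?w (a + cis t *s b) - ?m)) \<le> exp ?m * exp (p * ?w (a + cis t *s b) - ?m)"
          by (intro mult_left_mono exp_ge_add_one_self) auto
        then show ?thesis unfolding pw by (simp add: algebra_simps flip: exp_add)
      qed
    qed (intro integrable_continuous_real continuous_intros cw cg)+
    finally show ?thesis .
  qed
  have "(?g has_integral integral {0..2*pi} ?g) {0..2*pi}"
    by (intro integrable_integral integrable_continuous_real cg)
  then have "((\<lambda>t. if t \<in> {0..2*pi} then ?g t else 0) has_integral integral {0..2*pi} ?g) UNIV"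
    by (subst has_integral_restrict_UNIV)
  moreover have "(\<lambda>t. if t \<in> {0..2*pi} then ?g t else 0) = (\<lambda>t. indicator {0..2*pi} t * ?g t)"
    by auto
  ultimately have "((\<lambda>t. indicator {0..2*pi} t * ?g t) has_integral integral {0..2*pi} ?g) UNIV"
    by simp
  moreover have "(\<lambda>t. indicator {0..2*pi} t * ?g t) \<in> borel_measurable borel"
    using borel_measurable_continuous_on_indicator[OF _ cg] by (simp add: mult.commute)
  ultimately have "(\<integral>\<^sup>+ t. ennreal (indicator {0..2*pi} t * ?g t) \<partial>lborel) = ennreal (integral {0..2*pi} ?g)"
    by (intro nn_integral_has_integral_lborel) auto
  moreover have "ennreal (indicator {0..2*pi} t * ?g t) = ennreal (?g t) * indicator {0..2*pi} t" for t
    by (auto split: split_indicator)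
  ultimately have "(\<integral>\<^sup>+ t. ennreal (?g t) * indicator {0..2*pi} t \<partial>lborel) = ennreal (integral {0..2*pi} ?g)"
    by simp
  moreover have "ennreal (max (cmod (F a)) d powr p) * ennreal (2 * pi) = ennreal (exp ?m * (2 * pi))"
    unfolding pw by (simp add: ennreal_mult')
  ultimately show ?thesis using ennreal_leI[OF mean] by simp
qed

text \<open>The circle inequality is integrated over all radius vectors \<open>b\<close> in the ball
  and the integrals are exchanged. For each \<open>t\<close> the map
  \<open>b \<mapsto> a + cis t *s b\<close> preserves the measure and carries the ball about 0 to
  the ball about \<open>a\<close>, so polar coordinates are avoided.\<close>

lemma powr_le_ball_nn_integral:
  fixes F :: "complex^'n \<Rightarrow> complex"
  assumes F: "holo_n F (ball a \<rho>)" and d: "0 < d" and p: "0 \<le> p"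
  shows "ennreal (max (cmod (F a)) d powr p) * emeasure lborel (ball a \<rho>)
     \<le> (\<integral>\<^sup>+ z\<in>ball a \<rho>. ennreal (max (cmod (F z)) d powr p) \<partial>lborel)"
proof -
  \<comment> \<open>Extension by zero gives a Borel function on the whole space, as Fubini's theorem
    and the invariance lemmas require.\<close>
  define g where "g z = ennreal (max (cmod (F z)) d powr p) * indicator (ball a \<rho>) z" for z
  have "continuous_on (ball a \<rho>) (\<lambda>z. max (cmod (F z)) d powr p)"
    using d by (intro continuous_intros holo_n_imp_continuous_on[OF F]) (auto simp: max_def)
  then have "(\<lambda>z. indicator (ball a \<rho>) z * (max (cmod (F z)) d powr p)) \<in> borel_measurable borel"
    using borel_measurable_continuous_on_indicator[of "ball a \<rho>" "\<lambda>z. max (cmod (F z)) d powr p"] by simp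
  then have "(\<lambda>z. ennreal (indicator (ball a \<rho>) z * (max (cmod (F z)) d powr p))) \<in> borel_measurable borel"
    by measurable
  moreover have "(\<lambda>z. ennreal (indicator (ball a \<rho>) z * (max (cmod (F z)) d powr p))) = g"
    by (auto simp: g_def fun_eq_iff split: split_indicator)
  ultimately have [measurable]: "g \<in> borel_measurable borel" by simp
  have "continuous_on UNIV (\<lambda>x::(complex^'n) \<times> real. a + cis (snd x) *s fst x)"
    unfolding vector_scalar_mult_def by (intro continuous_intros continuous_on_vec_lambda)
  then have [measurable]: "(\<lambda>x::(complex^'n) \<times> real. a + cis (snd x) *s fst x) \<in> borel \<Otimes>\<^sub>M borel \<rightarrow>\<^sub>M borel"
    unfolding borel_prod by (rule borel_measurable_continuous_onI)
  have meas: "(\<lambda>(b, t). g (a + cis t *s b) * indicator {0..2*pi} t) \<in> borel_measurable (lborel \<Otimes>\<^sub>M lborel)"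
    unfolding split_beta' by measurable
  let ?M = "ennreal (max (cmod (F a)) d powr p)"
  have "?M * ennreal (2 * pi) * emeasure lborel (ball 0 \<rho> :: (complex^'n) set)
      = (\<integral>\<^sup>+ b. ?M * ennreal (2 * pi) * indicator (ball 0 \<rho>) b \<partial>(lborel :: (complex^'n) measure))"
    by (simp add: nn_integral_cmult_indicator)
  also have "\<dots> \<le> (\<integral>\<^sup>+ b. \<integral>\<^sup>+ t. g (a + cis t *s b) * indicator {0..2*pi} t \<partial>lborel \<partial>lborel)"
  proof (rule nn_integral_mono)
    fix b :: "complex^'n"
    show "?M * ennreal (2 * pi) * indicator (ball 0 \<rho>) b \<le> (\<integral>\<^sup>+ t. g (a + cis t *s b) * indicator {0..2*pi} t \<partial>lborel)"
    proof (cases "b \<in> ball 0 \<rho>")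
      case True
      have disc: "a + \<zeta> *s b \<in> ball a \<rho>" if "cmod \<zeta> \<le> 1" for \<zeta>
        using True that mult_right_mono[of "cmod \<zeta>" 1 "norm b"] by (simp add: dist_norm norm_cvector_scalar_mult)
      have "g (a + cis t *s b) = ennreal (max (cmod (F (a + cis t *s b))) d powr p)" for t
        using disc[of "cis t"] by (simp add: g_def)
      then show ?thesis using powr_le_circle_nn_integral[OF F d p disc] True by simp
    qed simp
  qed
  also have "\<dots> = (\<integral>\<^sup>+ t. \<integral>\<^sup>+ b. g (a + cis t *s b) * indicator {0..2*pi} t \<partial>lborel \<partial>lborel)"
    by (rule lborel_pair.Fubini'[OF meas, symmetric])
  also have "\<dots> = (\<integral>\<^sup>+ t. (\<integral>\<^sup>+ z. g z \<partial>lborel) * indicator {0..2*pi} t \<partial>(lborel :: real measure))"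
  proof (intro nn_integral_cong)
    fix t :: real
    have "(\<integral>\<^sup>+ b. g (a + cis t *s b) \<partial>lborel) = (\<integral>\<^sup>+ b. g (a + b) \<partial>lborel)"
      by (rule nn_integral_orthogonal_transformation[OF orthogonal_transformation_cis, of "\<lambda>b. g (a + b)"]) measurable
    also have "\<dots> = (\<integral>\<^sup>+ z. g z \<partial>lborel)" by (rule nn_integral_lborel_translate) measurable
    finally have "(\<integral>\<^sup>+ b. g (a + cis t *s b) \<partial>lborel) = (\<integral>\<^sup>+ z. g z \<partial>lborel)" .
    then show "(\<integral>\<^sup>+ b. g (a + cis t *s b) * indicator {0..2*pi} t \<partial>lborel) = (\<integral>\<^sup>+ z. g z \<partial>lborel) * indicator {0..2*pi} t"
      by (cases "t \<in> {0..2*pi}") auto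
  qed
  also have "\<dots> = (\<integral>\<^sup>+ z. g z \<partial>lborel) * ennreal (2 * pi)"
    by (simp add: nn_integral_cmult)
  finally have "ennreal (2 * pi) * (?M * emeasure lborel (ball 0 \<rho> :: (complex^'n) set)) \<le> ennreal (2 * pi) * (\<integral>\<^sup>+ z. g z \<partial>lborel)"
    by (simp add: mult_ac)
  then have "?M * emeasure lborel (ball 0 \<rho> :: (complex^'n) set) \<le> (\<integral>\<^sup>+ z. g z \<partial>lborel)"
    by (subst (asm) ennreal_mult_le_mult_iff) auto
  moreover have "emeasure lborel (ball 0 \<rho> :: (complex^'n) set) = emeasure lborel (ball a \<rho>)"
  proof -
    have "indicator (ball a \<rho>) (a + x) = (indicator (ball 0 \<rho>) x :: ennreal)" for x
      by (auto simp: dist_norm split: split_indicator)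
    then show ?thesis
      using nn_integral_lborel_translate[of "indicator (ball a \<rho>)" a, OF borel_measurable_indicator] by simp
  qed
  ultimately show ?thesis by (simp add: g_def)
qed

section \<open>Montel's theorem in several variables\<close>

text \<open>Cauchy's inequality for the restriction of \<open>F\<close> to the complex line through
  \<open>z\<close> in the direction \<open>v\<close>, whose derivative at 0 is
  \<open>L v\<close>.\<close>

lemma holo_n_Cauchy_estimate:
  fixes F :: "complex^'n \<Rightarrow> complex"
  assumes F: "holo_n F (ball c t)" and B: "\<And>z. z \<in> ball c t \<Longrightarrow> cmod (F z) \<le> B"
    and z: "z \<in> ball c s" and st: "s < t"
    and L: "(F has_derivative L) (at z)" "\<And>c v. L (c *s v) = c * L v"
  shows "cmod (L v) \<le> 2 * B / (t - s) * norm v"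
proof (cases "v = 0")
  case True
  then have "L v = 0" using L(2)[of 0 0] by simp
  with True show ?thesis by simp
next
  case False
  \<comment> \<open>With this radius the disc moves \<open>z\<close> by at most half of
    \<open>t - s\<close>, so the closed disc stays in the larger ball.\<close>
  define \<rho> where "\<rho> = (t - s) / (2 * norm v)"
  have \<rho>: "\<rho> > 0" using False st by (simp add: \<rho>_def)
  have inb: "z + \<zeta> *s v \<in> ball c t" if "cmod \<zeta> \<le> \<rho>" for \<zeta>
  proof -
    have "norm (\<zeta> *s v) \<le> \<rho> * norm v"
      using that by (simp add: norm_cvector_scalar_mult mult_right_mono)
    also have "\<dots> = (t - s) / 2" using False by (simp add: \<rho>_def)
    finally have "dist z (z + \<zeta> *s v) \<le> (t - s) / 2" by (simp add: dist_norm)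
    then show ?thesis using z st dist_triangle[of c "z + \<zeta> *s v" z] by (simp; argo)
  qed
  let ?g = "\<lambda>\<zeta>. F (z + \<zeta> *s v)"
  have hol: "?g holomorphic_on cball 0 \<rho>"
    by (rule holomorphic_on_subset[OF holo_n_line[OF F]]) (use inb in auto)
  have "cmod ((deriv ^^ 1) ?g 0) \<le> fact 1 * B / \<rho> ^ 1"
  proof (rule Cauchy_inequality)
    show "?g holomorphic_on ball 0 \<rho>" using hol by (rule holomorphic_on_subset) auto
    show "continuous_on (cball 0 \<rho>) ?g" using hol by (rule holomorphic_on_imp_continuous_on)
    show "cmod (?g x) \<le> B" if "cmod (0 - x) = \<rho>" for x using inb[of x] that by (intro B) auto
  qed (use \<rho> in auto)
  moreover have "(?g has_field_derivative L v) (at 0)"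
    by (rule holo_n_line_has_field_derivative) (use L in \<open>auto simp: vec_eq_iff\<close>)
  then have "deriv ?g 0 = L v" by (rule DERIV_imp_deriv)
  ultimately have "cmod (L v) \<le> B / \<rho>" by simp
  then show ?thesis using False st by (simp add: \<rho>_def mult_ac)
qed

section \<open>Equicontinuity and limits of holomorphic functions\<close>

lemma holo_n_has_derivative_frechet:
  assumes "holo_n F U" "z \<in> U"
  shows "(F has_derivative frechet_derivative F (at z)) (at z)"
    "frechet_derivative F (at z) (c *s v) = c * frechet_derivative F (at z) v"
proof -
  obtain L where L: "(F has_derivative L) (at z)" "\<And>c v. L (c *s v) = c * L v"
    using holo_nE[OF assms] by blast
  moreover have "frechet_derivative F (at z) = L" using frechet_derivative_at[OF L(1)] by simp
  ultimately show "(F has_derivative frechet_derivative F (at z)) (at z)"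
    "frechet_derivative F (at z) (c *s v) = c * frechet_derivative F (at z) v" by simp_all
qed

text \<open>The mean value inequality on the convex smaller ball, with the Cauchy estimate bounding
  the operator norm. This is the equicontinuity behind Montel's theorem.\<close>

lemma holo_n_Lipschitz:
  fixes F :: "complex^'n \<Rightarrow> complex"
  assumes F: "holo_n F (ball c t)" and B: "\<And>z. z \<in> ball c t \<Longrightarrow> cmod (F z) \<le> B" and st: "s < t"
    and xy: "x \<in> ball c s" "y \<in> ball c s"
  shows "cmod (F x - F y) \<le> 2 * B / (t - s) * norm (x - y)"
proof (rule differentiable_bound[OF convex_ball _ _ xy])
  fix z assume z: "z \<in> ball c s"
  then have zt: "z \<in> ball c t" using st by auto
  note D = holo_n_has_derivative_frechet[OF F zt]
  show "(F has_derivative frechet_derivative F (at z)) (at z within ball c s)"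
    using D(1) by (rule has_derivative_at_withinI)
  show "onorm (frechet_derivative F (at z)) \<le> 2 * B / (t - s)"
    by (rule onorm_le) (rule holo_n_Cauchy_estimate[OF F B z st D])
qed

text \<open>The Cauchy estimate for differences makes the derivatives uniformly Cauchy on the
  smaller ball, so the limit may be differentiated termwise. Complex linearity passes to the limit
  derivative.\<close>

lemma holo_n_uniform_limit:
  fixes F :: "nat \<Rightarrow> complex^'n \<Rightarrow> complex"
  assumes F: "\<And>n. holo_n (F n) (ball c t)" and st: "s < t"
    and uc: "\<And>e. e > 0 \<Longrightarrow> \<exists>N. \<forall>m\<ge>N. \<forall>n\<ge>N. \<forall>z\<in>ball c t. cmod (F m z - F n z) \<le> e"
  obtains G where "holo_n G (ball c s)" "\<And>z. z \<in> ball c s \<Longrightarrow> (\<lambda>n. F n z) \<longlonglongrightarrow> G z"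
proof (cases "s > 0")
  case False
  then have "ball c s = {}" by simp
  then show thesis by (intro that[of "\<lambda>_. 0"]) (simp_all only: holo_n_const open_empty empty_iff)
next
  case True
  define D where "D n z = frechet_derivative (F n) (at z)" for n z
  have sub: "z \<in> ball c s \<Longrightarrow> z \<in> ball c t" for z using st by auto
  have D: "(F n has_derivative D n z) (at z)" "D n z (a *s v) = a * D n z v" if "z \<in> ball c s" for n z a v
    unfolding D_def using holo_n_has_derivative_frechet[OF F sub[OF that]] by auto
  have DC: "\<exists>N. \<forall>m\<ge>N. \<forall>n\<ge>N. \<forall>z\<in>ball c s. \<forall>v. cmod (D m z v - D n z v) \<le> e * norm v" if "e > 0" for e
  proof -
    \<comment> \<open>The Cauchy estimate multiplies a bound by \<open>2 / (t - s)\<close>, so this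
      tolerance becomes \<open>e\<close>.\<close>
    have "e * (t - s) / 2 > 0" using that st by simp
    then obtain N where N: "\<And>m n z. m \<ge> N \<Longrightarrow> n \<ge> N \<Longrightarrow> z \<in> ball c t \<Longrightarrow> cmod (F m z - F n z) \<le> e * (t - s) / 2"
      using uc by meson
    have "cmod (D m z v - D n z v) \<le> e * norm v" if "m \<ge> N" "n \<ge> N" and z: "z \<in> ball c s" for m n z v
    proof -
      have "((\<lambda>z. F m z - F n z) has_derivative (\<lambda>v. D m z v - D n z v)) (at z)"
        by (intro has_derivative_diff D z)
      then have "cmod (D m z v - D n z v) \<le> 2 * (e * (t - s) / 2) / (t - s) * norm v"
        using holo_n_Cauchy_estimate[OF holo_n_diff[OF F F] N[OF that(1,2)] z st,
            where L = "\<lambda>v. D m z v - D n z v" and v = v]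
        by (simp add: D[OF z] algebra_simps)
      then show ?thesis using st by simp
    qed
    then show ?thesis by blast
  qed
  have "convergent (\<lambda>n. D n z v)" if z: "z \<in> ball c s" for z v
  proof (rule Cauchy_convergent, rule CauchyI)
    fix e :: real assume "e > 0"
    then have "e / (2 * (norm v + 1)) > 0" by (simp add: add_nonneg_pos)
    then obtain N where N: "\<And>m n. m \<ge> N \<Longrightarrow> n \<ge> N \<Longrightarrow> cmod (D m z v - D n z v) \<le> e / (2 * (norm v + 1)) * norm v"
      using DC z by meson
    have "e / (2 * (norm v + 1)) * norm v \<le> e / (2 * (norm v + 1)) * (norm v + 1)"
      using \<open>e / (2 * (norm v + 1)) > 0\<close> by (intro mult_left_mono) auto
    also have "\<dots> = e / 2" using norm_ge_zero[of v] by (simp add: field_simps add_nonneg_eq_0_iff)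
    also have "\<dots> < e" using \<open>e > 0\<close> by simp
    finally have "e / (2 * (norm v + 1)) * norm v < e" .
    with N show "\<exists>M. \<forall>m\<ge>M. \<forall>n\<ge>M. norm (D m z v - D n z v) < e" by (meson le_less_trans)
  qed
  then have lim: "(\<lambda>n. D n z v) \<longlonglongrightarrow> lim (\<lambda>n. D n z v)" if "z \<in> ball c s" for z v
    using that convergent_LIMSEQ_iff by blast
  define g' where "g' z v = lim (\<lambda>n. D n z v)" for z v
  have "\<exists>g. \<forall>x\<in>ball c s. (\<lambda>n. F n x) \<longlonglongrightarrow> g x \<and> (g has_derivative g' x) (at x within ball c s)"
  proof (rule has_derivative_sequence)
    show "(F n has_derivative D n x) (at x within ball c s)" if "x \<in> ball c s" for n x
      using D(1)[OF that] by (rule has_derivative_at_withinI)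
    show "c \<in> ball c s" using True by simp
    have "Cauchy (\<lambda>n. F n c)"
    proof (rule CauchyI)
      fix e :: real assume "e > 0"
      then obtain N where N: "\<And>m n z. m \<ge> N \<Longrightarrow> n \<ge> N \<Longrightarrow> z \<in> ball c t \<Longrightarrow> cmod (F m z - F n z) \<le> e / 2"
        using uc[of "e / 2"] by (meson half_gt_zero)
      have "norm (F m c - F n c) < e" if "m \<ge> N" "n \<ge> N" for m n
        using N[OF that, of c] \<open>e > 0\<close> True st by simp
      then show "\<exists>M. \<forall>m\<ge>M. \<forall>n\<ge>M. norm (F m c - F n c) < e" by blast
    qed
    then show "(\<lambda>n. F n c) \<longlonglongrightarrow> lim (\<lambda>n. F n c)"
      using Cauchy_convergent convergent_LIMSEQ_iff by blast
    fix e :: real assume "e > 0"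
    then obtain N where N: "\<And>m n z v. m \<ge> N \<Longrightarrow> n \<ge> N \<Longrightarrow> z \<in> ball c s \<Longrightarrow> cmod (D m z v - D n z v) \<le> e * norm v"
      using DC by meson
    \<comment> \<open>Letting the second index tend to infinity turns the uniform Cauchy condition
      into uniform convergence.\<close>
    have "cmod (D n z v - g' z v) \<le> e * norm v" if "n \<ge> N" "z \<in> ball c s" for n z v
    proof (rule tendsto_upperbound)
      show "(\<lambda>m. cmod (D n z v - D m z v)) \<longlonglongrightarrow> cmod (D n z v - g' z v)"
        unfolding g'_def by (intro tendsto_intros lim that)
      show "\<forall>\<^sub>F m in sequentially. cmod (D n z v - D m z v) \<le> e * norm v"
        unfolding eventually_sequentially using N[OF that(1) _ that(2)] by blast
    qed simp
    then show "\<forall>\<^sub>F n in sequentially. \<forall>x\<in>ball c s. \<forall>h. norm (D n x h - g' x h) \<le> e * norm h"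
      unfolding eventually_sequentially by blast
  qed simp
  then obtain g where g: "\<And>x. x \<in> ball c s \<Longrightarrow> (\<lambda>n. F n x) \<longlonglongrightarrow> g x"
    "\<And>x. x \<in> ball c s \<Longrightarrow> (g has_derivative g' x) (at x within ball c s)" by blast
  have "holo_n g (ball c s)"
    unfolding holo_n_def
  proof (intro conjI ballI exI allI)
    fix z assume z: "z \<in> ball c s"
    show "(g has_derivative g' z) (at z)" using g(2)[OF z] unfolding at_within_open[OF z open_ball] .
    fix a v
    have "(\<lambda>n. D n z (a *s v)) \<longlonglongrightarrow> a * g' z v"
      unfolding D(2)[OF z] g'_def by (intro tendsto_intros lim z)
    then show "g' z (a *s v) = a * g' z v" unfolding g'_def by (rule limI)
  qed simp
  then show thesis using that g(1) by blast
qed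

text \<open>A subsequence converges on a countable dense set; the Lipschitz bounds make it uniformly
  Cauchy on smaller balls, and \<open>holo_n_uniform_limit\<close> applies there. Each
  \<open>F k\<close> need be holomorphic on a given smaller ball only for large \<open>k\<close>,
  which suits functions on growing balls.\<close>

lemma holo_n_Montel:
  fixes F :: "nat \<Rightarrow> complex^'n \<Rightarrow> complex"
  assumes bd: "\<And>t. t < r \<Longrightarrow> \<exists>N B. \<forall>k\<ge>N. holo_n (F k) (ball c t) \<and> (\<forall>z\<in>ball c t. cmod (F k z) \<le> B)"
  obtains \<sigma> G where "strict_mono (\<sigma> :: nat \<Rightarrow> nat)" "holo_n G (ball c r)"
    "\<And>z. z \<in> ball c r \<Longrightarrow> (\<lambda>k. F (\<sigma> k) z) \<longlonglongrightarrow> G z"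
proof -
  have pb: "\<exists>B>0. \<forall>\<^sub>F k in sequentially. cmod (F k z) \<le> B" if "z \<in> ball c r" for z
  proof -
    have t: "(dist c z + r) / 2 < r" "z \<in> ball c ((dist c z + r) / 2)" using that by auto
    obtain N B where "\<forall>k\<ge>N. holo_n (F k) (ball c ((dist c z + r) / 2)) \<and> (\<forall>z\<in>ball c ((dist c z + r) / 2). cmod (F k z) \<le> B)"
      using bd[OF t(1)] by blast
    then have "\<forall>k\<ge>N. cmod (F k z) \<le> max B 1" using t(2) by (metis max.coboundedI1)
    then show ?thesis unfolding eventually_sequentially by (intro exI[of _ "max B 1"]) auto
  qed
  then obtain B where B: "\<And>z. z \<in> ball c r \<Longrightarrow> B z > 0"
      "\<And>z. z \<in> ball c r \<Longrightarrow> \<forall>\<^sub>F k in sequentially. cmod (F k z) \<le> B z" by metis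
  obtain D0 :: "(complex^'n) set" where D0: "countable D0" "\<And>X. open X \<Longrightarrow> X \<noteq> {} \<Longrightarrow> \<exists>d\<in>D0. d \<in> X"
    using countable_dense_exists by blast
  define D where "D = D0 \<inter> ball c r"
  \<comment> \<open>Normalization for the diagonal argument, which needs the bound 1 for every
    index; the finitely many indices where \<open>B z\<close> fails at a point are set to 0.\<close>
  define f where "f n z = (if cmod (F n z) \<le> B z then F n z / of_real (B z) else 0)" for n z
  have "cmod (f n z) \<le> 1" if "z \<in> D" for n z
    using B(1)[of z] that by (auto simp: f_def D_def norm_divide)
  then obtain \<sigma> where \<sigma>: "strict_mono \<sigma>" "\<And>z. z \<in> D \<Longrightarrow> \<exists>l. (\<lambda>n. f (\<sigma> n) z) \<longlonglongrightarrow> l"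
    using function_convergent_subsequence[of D f 1] countable_subset[OF _ D0(1), of D]
    unfolding D_def by blast
  have convD: "Cauchy (\<lambda>n. F (\<sigma> n) z)" if z: "z \<in> D" for z
  proof -
    obtain l where "(\<lambda>n. f (\<sigma> n) z) \<longlonglongrightarrow> l" using \<sigma>(2)[OF z] by blast
    then have "(\<lambda>n. of_real (B z) * f (\<sigma> n) z) \<longlonglongrightarrow> of_real (B z) * l" by (intro tendsto_intros)
    moreover have "\<forall>\<^sub>F n in sequentially. of_real (B z) * f (\<sigma> n) z = F (\<sigma> n) z"
      using eventually_subseq[OF \<sigma>(1) B(2)[of z]] z
      by (auto simp: D_def f_def elim!: eventually_mono dest!: B(1))
    ultimately have "(\<lambda>n. F (\<sigma> n) z) \<longlonglongrightarrow> of_real (B z) * l" by (rule Lim_transform_eventually)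
    then show ?thesis by (rule LIMSEQ_imp_Cauchy)
  qed
  have loc: "\<exists>N. (\<forall>k\<ge>N. holo_n (F (\<sigma> k)) (ball c t)) \<and>
      (\<forall>e>0. \<exists>M\<ge>N. \<forall>m\<ge>M. \<forall>n\<ge>M. \<forall>z\<in>ball c t. cmod (F (\<sigma> m) z - F (\<sigma> n) z) \<le> e)" if "t < r" for t
  proof -
    \<comment> \<open>Four nested radii: bounds hold on the ball of radius \<open>w\<close>,
      Lipschitz estimates and the covering centres live on \<open>u\<close>, and uniform convergence
      is shown on \<open>t\<close>.\<close>
    define u where "u = (t + r) / 2"
    define w where "w = (u + r) / 2"
    have tu: "t < u" "u < w" "w < r" using that by (auto simp: u_def w_def)
    obtain N A where NA: "\<forall>k\<ge>N. holo_n (F k) (ball c w) \<and> (\<forall>z\<in>ball c w. cmod (F k z) \<le> A)"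
      using bd[OF tu(3)] by blast
    have \<sigma>N: "\<sigma> k \<ge> N" if "k \<ge> N" for k using seq_suble[OF \<sigma>(1), of k] that by simp
    define K where "K = \<bar>2 * A / (w - u)\<bar> + 1"
    have K: "K > 0" unfolding K_def by (rule add_nonneg_pos) auto
    have Lip: "cmod (F (\<sigma> k) x - F (\<sigma> k) y) \<le> K * dist x y" if "k \<ge> N" "x \<in> ball c u" "y \<in> ball c u" for k x y
    proof -
      have "cmod (F (\<sigma> k) x - F (\<sigma> k) y) \<le> 2 * A / (w - u) * norm (x - y)"
        using NA \<sigma>N[OF that(1)] by (intro holo_n_Lipschitz[OF _ _ tu(2) that(2,3)]) auto
      also have "\<dots> \<le> K * norm (x - y)" 
        using abs_ge_self[of "2 * A / (w - u)"] unfolding K_def by (intro mult_right_mono norm_ge_zero) linarith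
      finally show ?thesis by (simp add: dist_norm)
    qed
    have "\<exists>M\<ge>N. \<forall>m\<ge>M. \<forall>n\<ge>M. \<forall>z\<in>ball c t. cmod (F (\<sigma> m) z - F (\<sigma> n) z) \<le> e" if e: "e > 0" for e
    proof -
      \<comment> \<open>Moving a point to a covering centre at distance below
        \<open>\<delta>\<close> costs at most \<open>e / 3\<close>; this happens twice, and the
        centre itself costs another \<open>e / 3\<close>.\<close>
      define \<delta> where "\<delta> = e / (3 * K)"
      have \<delta>: "\<delta> > 0" using e K by (simp add: \<delta>_def)
      have "cball c t \<subseteq> (\<Union>d\<in>D \<inter> ball c u. ball d \<delta>)"
      proof
        fix z assume z: "z \<in> cball c t"
        have "z \<in> ball z \<delta> \<inter> ball c u" using z \<delta> tu by auto
        then obtain d where "d \<in> D0" "d \<in> ball z \<delta> \<inter> ball c u"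
          using D0(2)[of "ball z \<delta> \<inter> ball c u"] by blast
        then show "z \<in> (\<Union>d\<in>D \<inter> ball c u. ball d \<delta>)" using tu by (auto simp: D_def dist_commute)
      qed
      then obtain E where E: "E \<subseteq> D \<inter> ball c u" "finite E" "cball c t \<subseteq> (\<Union>d\<in>E. ball d \<delta>)"
        using compactE_image[OF compact_cball, of "D \<inter> ball c u" "\<lambda>d. ball d \<delta>" c t] by auto
      have "\<exists>M. \<forall>m\<ge>M. \<forall>n\<ge>M. cmod (F (\<sigma> m) d - F (\<sigma> n) d) < e / 3" if "d \<in> E" for d
        using CauchyD[OF convD[of d], of "e / 3"] that E(1) e by auto
      then obtain M where M: "\<And>d m n. d \<in> E \<Longrightarrow> m \<ge> M d \<Longrightarrow> n \<ge> M d \<Longrightarrow> cmod (F (\<sigma> m) d - F (\<sigma> n) d) < e / 3"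
        by metis
      define M' where "M' = Max (insert N (M ` E))"
      have M': "M' \<ge> N" "\<And>d. d \<in> E \<Longrightarrow> M' \<ge> M d" using E(2) by (auto simp: M'_def)
      have "cmod (F (\<sigma> m) z - F (\<sigma> n) z) \<le> e" if mn: "m \<ge> M'" "n \<ge> M'" and z: "z \<in> ball c t" for m n z
      proof -
        obtain d where d: "d \<in> E" "dist d z < \<delta>" using z E(3) by (force simp: subset_iff)
        have du: "d \<in> ball c u" "z \<in> ball c u" using d E(1) z tu by auto
        have Kd: "K * dist d z \<le> e / 3" using d(2) K by (simp add: \<delta>_def field_simps)
        have "cmod (F (\<sigma> m) z - F (\<sigma> m) d) \<le> e / 3"
          using Lip[of m z d] du mn M' Kd by (auto simp: dist_commute intro: order_trans)
        moreover have "cmod (F (\<sigma> n) d - F (\<sigma> n) z) \<le> e / 3"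
          using Lip[of n d z] du mn M' Kd by (auto intro: order_trans)
        moreover have "cmod (F (\<sigma> m) d - F (\<sigma> n) d) \<le> e / 3"
          using M[OF d(1), of m n] M'(2)[OF d(1)] mn by simp
        moreover have "cmod (F (\<sigma> m) z - F (\<sigma> n) z) \<le> cmod (F (\<sigma> m) z - F (\<sigma> m) d)
            + cmod (F (\<sigma> m) d - F (\<sigma> n) d) + cmod (F (\<sigma> n) d - F (\<sigma> n) z)"
          using norm_triangle_ineq[of "F (\<sigma> m) z - F (\<sigma> m) d" "F (\<sigma> m) d - F (\<sigma> n) d"]
            norm_triangle_ineq[of "F (\<sigma> m) z - F (\<sigma> n) d" "F (\<sigma> n) d - F (\<sigma> n) z"] by simp
        ultimately show ?thesis by linarith
      qed
      with M'(1) show ?thesis by blast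
    qed
    moreover have "holo_n (F (\<sigma> k)) (ball c t)" if "k \<ge> N" for k
    proof (rule holo_n_subset)
      show "holo_n (F (\<sigma> k)) (ball c w)" using NA \<sigma>N[OF that] by blast
      show "ball c t \<subseteq> ball c w" using tu by (intro subset_ball) linarith
    qed simp
    ultimately show ?thesis by (intro exI[of _ N]) simp
  qed
  have local: "\<exists>G. holo_n G (ball c s) \<and> (\<forall>z\<in>ball c s. (\<lambda>n. F (\<sigma> n) z) \<longlonglongrightarrow> G z)" if "s < r" for s
  proof -
    define t where "t = (s + r) / 2"
    have t: "s < t" "t < r" using that by (auto simp: t_def)
    from loc[OF t(2)] obtain N where N: "\<And>k. k \<ge> N \<Longrightarrow> holo_n (F (\<sigma> k)) (ball c t)"
      "\<And>e. e > 0 \<Longrightarrow> \<exists>M\<ge>N. \<forall>m\<ge>M. \<forall>n\<ge>M. \<forall>z\<in>ball c t. cmod (F (\<sigma> m) z - F (\<sigma> n) z) \<le> e" by blast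
    obtain G where G: "holo_n G (ball c s)" "\<And>z. z \<in> ball c s \<Longrightarrow> (\<lambda>n. F (\<sigma> (n + N)) z) \<longlonglongrightarrow> G z"
    proof (rule holo_n_uniform_limit[of "\<lambda>n. F (\<sigma> (n + N))" c t s])
      fix e :: real assume "e > 0"
      then obtain M where "\<forall>m\<ge>M. \<forall>n\<ge>M. \<forall>z\<in>ball c t. cmod (F (\<sigma> m) z - F (\<sigma> n) z) \<le> e" using N(2) by blast
      then show "\<exists>M. \<forall>m\<ge>M. \<forall>n\<ge>M. \<forall>z\<in>ball c t. cmod (F (\<sigma> (m + N)) z - F (\<sigma> (n + N)) z) \<le> e"
        by (intro exI[of _ M]) (simp add: trans_le_add1)
    qed (use N(1) t in auto)
    have "(\<lambda>n. F (\<sigma> n) z) \<longlonglongrightarrow> G z" if "z \<in> ball c s" for z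
      using G(2)[OF that] by (rule LIMSEQ_offset)
    with G(1) show ?thesis by blast
  qed
  \<comment> \<open>A single pointwise limit: by uniqueness of limits it agrees with every local
    holomorphic limit.\<close>
  define G where "G z = lim (\<lambda>n. F (\<sigma> n) z)" for z
  have G: "holo_n G (ball c s) \<and> (\<forall>z\<in>ball c s. (\<lambda>n. F (\<sigma> n) z) \<longlonglongrightarrow> G z)" if sr: "s < r" for s
  proof -
    obtain H where H: "holo_n H (ball c s)" "\<forall>z\<in>ball c s. (\<lambda>n. F (\<sigma> n) z) \<longlonglongrightarrow> H z"
      using local[OF sr] by blast
    then have eq: "\<And>z. z \<in> ball c s \<Longrightarrow> H z = G z" unfolding G_def by (metis limI)
    have "holo_n G (ball c s)"
      unfolding holo_n_def
    proof (intro conjI ballI)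
      fix z assume z: "z \<in> ball c s"
      obtain L where L: "(H has_derivative L) (at z)" "\<And>c v. L (c *s v) = c * L v"
        using holo_nE[OF H(1) z] by blast
      have "(G has_derivative L) (at z)"
        by (rule has_derivative_transform_within_open[OF L(1) open_ball z eq])
      then show "\<exists>L. (G has_derivative L) (at z) \<and> (\<forall>c v. L (c *s v) = c * L v)" using L(2) by blast
    qed simp
    with H(2) eq show ?thesis by simp
  qed
  have near: "\<exists>s<r. z \<in> ball c s" if "z \<in> ball c r" for z
    using that dense[of "dist c z" r] by auto
  have "holo_n G (ball c r)"
    unfolding holo_n_def
  proof (intro conjI ballI)
    fix z assume "z \<in> ball c r"
    then obtain s where "s < r" "z \<in> ball c s" using near by blast
    then show "\<exists>L. (G has_derivative L) (at z) \<and> (\<forall>c v. L (c *s v) = c * L v)"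
      using G[of s] unfolding holo_n_def by simp
  qed simp
  moreover have "(\<lambda>k. F (\<sigma> k) z) \<longlonglongrightarrow> G z" if "z \<in> ball c r" for z
    using near[OF that] G by (elim exE conjE) simp
  ultimately show thesis using that \<sigma>(1) by blast
qed

section \<open>The extension theorem\<close>

text \<open>Since \<open>q\<close> is at most \<open>M\<close>, the weighted integral controls the
  unweighted one up to the factor \<open>exp M\<close>. The sub-mean value property on balls of
  radius \<open>s - t\<close> then bounds values; its truncation level 1 accounts for the added
  volume.\<close>

lemma local_bound_of_weighted_integral:
  fixes F :: "complex^'n \<Rightarrow> complex"
  assumes F: "holo_n F (ball c s)" and ts: "t < s" and p: "0 \<le> p"
    and q: "usc_on (ball c s) q" "\<And>z. z \<in> ball c s \<Longrightarrow> q z \<le> M"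
    and I: "(\<integral>\<^sup>+ z\<in>ball c s. ennreal (cmod (F z) powr p * exp (- q z)) \<partial>lborel) \<le> ennreal A" "0 \<le> A"
    and a: "a \<in> ball c t"
  shows "cmod (F a) powr p * measure lborel (ball (0 :: complex^'n) (s - t)) \<le> exp M * A + measure lborel (ball c s)"
proof -
  let ?\<rho> = "s - t"
  let ?N = "restrict_space lborel (ball c s)"
  have [measurable]: "F \<in> borel_measurable ?N" "q \<in> borel_measurable ?N"
    using F q by (auto intro: borel_measurable_restrict_lborel_continuous borel_measurable_restrict_lborel_usc holo_n_imp_continuous_on)
  have sub: "ball a ?\<rho> \<subseteq> ball c s"
  proof
    fix z assume "z \<in> ball a ?\<rho>"
    then show "z \<in> ball c s" using a dist_triangle[of c z a] by simp
  qed
  have fin: "emeasure lborel (ball a ?\<rho>) = ennreal (measure lborel (ball (0 :: complex^'n) ?\<rho>))"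
    using emeasure_lborel_ball_finite[of a ?\<rho>] ts
    by (simp add: emeasure_eq_ennreal_measure content_ball)
  have "ennreal (cmod (F a) powr p) * emeasure lborel (ball a ?\<rho>)
     \<le> ennreal (max (cmod (F a)) 1 powr p) * emeasure lborel (ball a ?\<rho>)"
    using p by (intro mult_right_mono ennreal_leI powr_mono2) auto
  also have "\<dots> \<le> (\<integral>\<^sup>+ z\<in>ball a ?\<rho>. ennreal (max (cmod (F z)) 1 powr p) \<partial>lborel)"
    using p by (intro powr_le_ball_nn_integral holo_n_subset[OF F _ sub]) auto
  also have "\<dots> \<le> (\<integral>\<^sup>+ z\<in>ball c s. ennreal (max (cmod (F z)) 1 powr p) \<partial>lborel)"
    using sub by (intro nn_integral_mono) (auto split: split_indicator)
  also have "\<dots> = (\<integral>\<^sup>+ z. ennreal (max (cmod (F z)) 1 powr p) \<partial>?N)"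
    by (simp add: nn_integral_restrict_space)
  also have "\<dots> \<le> (\<integral>\<^sup>+ z. ennreal (exp M) * ennreal (cmod (F z) powr p * exp (- q z)) + 1 \<partial>?N)"
  proof (rule nn_integral_mono)
    fix z assume "z \<in> space ?N"
    then have z: "z \<in> ball c s" by (simp add: space_restrict_space)
    have "1 \<le> exp M * exp (- q z)" using q(2)[OF z] by (simp flip: exp_add)
    then have "cmod (F z) powr p * 1 \<le> cmod (F z) powr p * (exp M * exp (- q z))"
      by (intro mult_left_mono) auto
    then have "max (cmod (F z)) 1 powr p \<le> exp M * (cmod (F z) powr p * exp (- q z)) + 1"
      using max_powr_le_add[of "cmod (F z)" 1 p] by (simp add: mult_ac)
    then show "ennreal (max (cmod (F z)) 1 powr p) \<le> ennreal (exp M) * ennreal (cmod (F z) powr p * exp (- q z)) + 1"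
      by (simp add: ennreal_mult'[symmetric] flip: ennreal_1 ennreal_plus)
  qed
  also have "\<dots> = ennreal (exp M) * (\<integral>\<^sup>+ z. ennreal (cmod (F z) powr p * exp (- q z)) \<partial>?N) + emeasure ?N (space ?N)"
    by (subst nn_integral_add) (auto simp: nn_integral_cmult)
  also have "emeasure ?N (space ?N) = ennreal (measure lborel (ball c s))"
    using emeasure_lborel_ball_finite[of c s]
    by (simp add: emeasure_restrict_space space_restrict_space emeasure_eq_ennreal_measure[of lborel])
  also have "(\<integral>\<^sup>+ z. ennreal (cmod (F z) powr p * exp (- q z)) \<partial>?N) \<le> ennreal A"
    using I(1) by (simp add: nn_integral_restrict_space)
  finally have "ennreal (cmod (F a) powr p) * ennreal (measure lborel (ball (0 :: complex^'n) ?\<rho>))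
     \<le> ennreal (exp M) * ennreal A + ennreal (measure lborel (ball c s))"
    unfolding fin by (simp add: add_mono mult_left_mono)
  then have "ennreal (cmod (F a) powr p * measure lborel (ball (0 :: complex^'n) ?\<rho>))
     \<le> ennreal (exp M * A + measure lborel (ball c s))"
    using I(2) by (simp add: ennreal_mult' ennreal_plus)
  then show ?thesis using I(2) by (subst (asm) ennreal_le_iff) auto
qed

theorem theorem0p3:
  fixes c :: "complex^'n" and r :: real and h :: "complex^'n \<Rightarrow> complex"
    and \<phi> :: "complex^'n \<Rightarrow> ereal" and f :: "complex^'n \<Rightarrow> complex"
    and m :: nat and C0 :: real
  assumes OT: "OT_holds TYPE('n) C0"
    and data: "ot_data c r h \<phi>"
    and m: "m \<ge> 1"
    and hf: "holo_on_subvariety f (zero_set c r h)"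
    and bnd: "(\<integral>\<^sup>+ z\<in>zero_set c r h. ennreal ((cmod (f z)) powr (2 / real m)) * exp_neg (\<phi> z)
                 / ennreal (dh_norm_sq h z) \<partial>hausdorff_measure (2 * CARD('n) - 2)) \<le> 1"
  shows "\<exists>F. holo_n F (ball c r) \<and> (\<forall>z\<in>zero_set c r h. F z = f z) \<and>
     (\<integral>\<^sup>+ z\<in>ball c r. ennreal ((cmod (F z)) powr (2 / real m)) * exp_neg (\<phi> z) \<partial>lborel)
       \<le> ennreal C0 * (\<integral>\<^sup>+ z\<in>zero_set c r h. ennreal ((cmod (f z)) powr (2 / real m)) * exp_neg (\<phi> z)
             / ennreal (dh_norm_sq h z) \<partial>hausdorff_measure (2 * CARD('n) - 2))"
proof -
  define p where "p = 2 / real m"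
  have p: "p > 0" using m by (simp add: p_def)
  define K where "K = ennreal C0 * (\<integral>\<^sup>+ z\<in>zero_set c r h. ennreal ((cmod (f z)) powr (2 / real m)) * exp_neg (\<phi> z)
             / ennreal (dh_norm_sq h z) \<partial>hausdorff_measure (2 * CARD('n) - 2))"
  \<comment> \<open>The normalization of the integral over the zero set enters as finiteness of
    \<open>K\<close>.\<close>
  have "K \<le> ennreal C0 * 1" unfolding K_def by (intro mult_left_mono bnd) auto
  then have Kfin: "K < \<infinity>" by (simp add: order_le_less_trans)
  then obtain \<kappa> where \<kappa>: "K = ennreal \<kappa>" "\<kappa> \<ge> 0" by (cases K) auto
  have fin: "\<And>z. z \<in> ball c r \<Longrightarrow> \<phi> z \<noteq> \<infinity>"
    using data by (auto simp: ot_data_def psh_on_def)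
  have psh: "psh_on (ball c r) \<phi>" using data by (simp add: ot_data_def)
  have usc: "usc_on (ball c r) (cutoff \<phi> j)" for j by (rule usc_on_cutoff[OF psh])

  \<comment> \<open>Extensions on an exhausting sequence of balls\<close>
  obtain z0 where z0: "dist c z0 < r" "h z0 = 0" using data by (auto simp: ot_data_def)
  \<comment> \<open>The factor is at most one half, so \<open>z0\<close> stays strictly inside every
    ball and each smaller zero set is nonempty.\<close>
  define s where "s k = r - (r - dist c z0) * inverse (real (Suc (Suc k)))" for k :: nat
  have s: "dist c z0 < s k" "s k < r" for k
  proof -
    have "(r - dist c z0) * inverse (real (Suc (Suc k))) < (r - dist c z0) * 1"
      using z0 by (intro mult_strict_left_mono) (auto simp: inverse_less_1_iff)
    then show "dist c z0 < s k" by (simp add: s_def)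
    show "s k < r" using z0 by (simp add: s_def)
  qed
  have s_ge: "\<exists>N. \<forall>k\<ge>N. t < s k" if "t < r" for t
  proof -
    have "s \<longlonglongrightarrow> r - (r - dist c z0) * 0"
      unfolding s_def by (intro tendsto_intros LIMSEQ_Suc[OF LIMSEQ_inverse_real_of_nat])
    then have "s \<longlonglongrightarrow> r" by simp
    then show ?thesis using that order_tendstoD(1) eventually_sequentially by metis
  qed
  \<comment> \<open>Radius, truncation level and error all depend on the one index \<open>k\<close>,
    so a single sequence serves all three limits.\<close>
  have ex: "\<exists>F. holo_n F (ball c (s k)) \<and> (\<forall>z\<in>zero_set c (s k) h. F z = f z) \<and>
    (\<integral>\<^sup>+ z\<in>ball c (s k). ennreal (cmod (F z) powr p * exp (- cutoff \<phi> (real k) z)) \<partial>lborel) \<le> K + ennreal (inverse (real (Suc k)))" for k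
  proof -
    have "zero_set c (s k) h \<noteq> {}" using z0 s(1)[of k] by (auto simp: zero_set_def)
    then show ?thesis
    proof (rule almost_optimal_extension[OF OT data m hf s(2) _ _ K_def Kfin, of k "inverse (real (Suc k))" "real k"])
      fix F assume "holo_n F (ball c (s k))" "\<And>z. z \<in> zero_set c (s k) h \<Longrightarrow> F z = f z"
        "(\<integral>\<^sup>+ z\<in>ball c (s k). ennreal (cmod (F z) powr (2 / real m) * exp (- cutoff \<phi> (real k) z)) \<partial>lborel) \<le> K + ennreal (inverse (real (Suc k)))"
      then show ?thesis unfolding p_def by (intro exI[of _ F]) simp
    qed simp
  qed
  have "\<exists>F. \<forall>k. holo_n (F k) (ball c (s k)) \<and> (\<forall>z\<in>zero_set c (s k) h. F k z = f z) \<and>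
    (\<integral>\<^sup>+ z\<in>ball c (s k). ennreal (cmod (F k z) powr p * exp (- cutoff \<phi> (real k) z)) \<partial>lborel) \<le> K + ennreal (inverse (real (Suc k)))"
    by (rule choice) (rule allI, rule ex)
  then obtain F where FF: "\<forall>k. holo_n (F k) (ball c (s k)) \<and> (\<forall>z\<in>zero_set c (s k) h. F k z = f z) \<and>
    (\<integral>\<^sup>+ z\<in>ball c (s k). ennreal (cmod (F k z) powr p * exp (- cutoff \<phi> (real k) z)) \<partial>lborel) \<le> K + ennreal (inverse (real (Suc k)))"
    by (elim exE)
  then have F: "\<And>k. holo_n (F k) (ball c (s k))"
    "\<And>k z. z \<in> zero_set c (s k) h \<Longrightarrow> F k z = f z"
    "\<And>k. (\<integral>\<^sup>+ z\<in>ball c (s k). ennreal (cmod (F k z) powr p * exp (- cutoff \<phi> (real k) z)) \<partial>lborel) \<le> K + ennreal (inverse (real (Suc k)))"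
    by simp_all

  \<comment> \<open>Local bounds and the limit function\<close>
  have "\<exists>N B. \<forall>k\<ge>N. holo_n (F k) (ball c t) \<and> (\<forall>z\<in>ball c t. cmod (F k z) \<le> B)" if "t < r" for t
  proof -
    define u where "u = (t + r) / 2"
    have u: "t < u" "u < r" using that by (auto simp: u_def)
    obtain N where N: "\<And>k. k \<ge> N \<Longrightarrow> u < s k" using s_ge[OF u(2)] by blast
    have "cball c u \<subseteq> ball c r" using u(2) by auto
    \<comment> \<open>The truncation at level 0 majorizes those at all levels \<open>real k\<close>,
      so \<open>M\<close> serves every \<open>k\<close>.\<close>
    then obtain M where M: "\<And>z. z \<in> cball c u \<Longrightarrow> cutoff \<phi> 0 z \<le> M"
      using usc_on_bounded_above[OF usc[of 0] compact_cball] by blast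
    define v where "v = measure lborel (ball (0 :: complex^'n) (u - t))"
    have v: "v > 0" using u by (simp add: v_def content_ball_pos)
    define A where "A = (exp M * (\<kappa> + 1) + measure lborel (ball c u)) / v"
    have "holo_n (F k) (ball c t) \<and> (\<forall>z\<in>ball c t. cmod (F k z) \<le> A powr (1 / p))" if "k \<ge> N" for k
    proof (intro conjI ballI)
      have su: "ball c u \<subseteq> ball c (s k)" "ball c t \<subseteq> ball c (s k)" using N[OF that] u by auto
      then show "holo_n (F k) (ball c t)" by (intro holo_n_subset[OF F(1)]) simp_all
      fix a assume a: "a \<in> ball c t"
      have "cmod (F k a) powr p * v \<le> exp M * (\<kappa> + 1) + measure lborel (ball c u)"
        unfolding v_def
      proof (rule local_bound_of_weighted_integral[OF holo_n_subset[OF F(1) _ su(1)] u(1) less_imp_le[OF p] _ _ _ _ a])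
        show "usc_on (ball c u) (cutoff \<phi> (real k))"
          using ot_data_imp_usc_cutoff(1)[OF data, of u] u by simp
        show "cutoff \<phi> (real k) z \<le> M" if "z \<in> ball c u" for z
          using cutoff_antimono[of \<phi> z 0 "real k", OF fin] M[of z] that u by auto
        have "(\<integral>\<^sup>+ z\<in>ball c u. ennreal (cmod (F k z) powr p * exp (- cutoff \<phi> (real k) z)) \<partial>lborel)
           \<le> (\<integral>\<^sup>+ z\<in>ball c (s k). ennreal (cmod (F k z) powr p * exp (- cutoff \<phi> (real k) z)) \<partial>lborel)"
          using su(1) by (intro nn_integral_mono) (auto split: split_indicator)
        also have "\<dots> \<le> K + ennreal (inverse (real (Suc k)))" by (rule F(3))
        also have "\<dots> \<le> ennreal \<kappa> + ennreal 1" unfolding \<kappa>(1) by (intro add_left_mono ennreal_leI) (simp add: field_simps)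
        also have "\<dots> = ennreal (\<kappa> + 1)" using \<kappa>(2) by simp
        finally show "(\<integral>\<^sup>+ z\<in>ball c u. ennreal (cmod (F k z) powr p * exp (- cutoff \<phi> (real k) z)) \<partial>lborel) \<le> ennreal (\<kappa> + 1)" .
      qed (use \<kappa> in auto)
      then have "cmod (F k a) powr p \<le> A" using v by (simp add: A_def field_simps)
      then have "(cmod (F k a) powr p) powr (1 / p) \<le> A powr (1 / p)" using p by (intro powr_mono2) auto
      then show "cmod (F k a) \<le> A powr (1 / p)" using p by (simp add: powr_powr)
    qed
    then show ?thesis by blast
  qed
  then obtain \<sigma> G where \<sigma>: "strict_mono (\<sigma> :: nat \<Rightarrow> nat)" and G: "holo_n G (ball c r)"
    and conv: "\<And>z. z \<in> ball c r \<Longrightarrow> (\<lambda>k. F (\<sigma> k) z) \<longlonglongrightarrow> G z"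
    using holo_n_Montel[of r F c] by blast
  \<comment> \<open>Each point of the large ball lies in all but finitely many of the smaller
    balls.\<close>
  have ev: "\<forall>\<^sub>F k in sequentially. z \<in> ball c (s (\<sigma> k))" if zr: "z \<in> ball c r" for z
  proof -
    obtain N where "\<forall>k\<ge>N. dist c z < s k" using s_ge[of "dist c z"] zr by auto
    then have "\<forall>\<^sub>F k in sequentially. dist c z < s k" by (auto simp: eventually_sequentially)
    from eventually_subseq[OF \<sigma> this] show ?thesis by simp
  qed
  have Gf: "G z = f z" if z: "z \<in> zero_set c r h" for z
  proof -
    have zb: "z \<in> ball c r" using z by (simp add: zero_set_def)
    have "\<forall>\<^sub>F k in sequentially. F (\<sigma> k) z = f z"
      using ev[OF zb] by eventually_elim (use z in \<open>auto simp: zero_set_def intro: F(2)\<close>)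
    then have "(\<lambda>k. F (\<sigma> k) z) \<longlonglongrightarrow> f z" by (rule tendsto_eventually)
    then show ?thesis using conv[OF zb] LIMSEQ_unique by blast
  qed

  \<comment> \<open>The weighted estimate for the limit\<close>
  define N where "N = restrict_space lborel (ball c r)"
  have [measurable]: "G \<in> borel_measurable N" "cutoff \<phi> j \<in> borel_measurable N" for j
    unfolding N_def using usc
    by (auto intro: borel_measurable_restrict_lborel_continuous borel_measurable_restrict_lborel_usc holo_n_imp_continuous_on[OF G])
  \<comment> \<open>Fatou's lemma with the truncation level \<open>l\<close> held fixed.\<close>
  have step: "(\<integral>\<^sup>+ z. ennreal (cmod (G z) powr p * exp (- cutoff \<phi> (real l) z)) \<partial>N) \<le> K" for l
  proof -
    \<comment> \<open>The indicator restricts to the ball where \<open>F (\<sigma> k)\<close> is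
      controlled; at each point of the large ball it is eventually 1.\<close>
    define u where "u k z = ennreal (cmod (F (\<sigma> k) z) powr p * exp (- cutoff \<phi> (real l) z)) * indicator (ball c (s (\<sigma> k))) z" for k z
    have meas: "u k \<in> borel_measurable N" for k
    proof -
      let ?B = "ball c (s (\<sigma> k))"
      have sub: "?B \<subseteq> ball c r" using s(2)[of "\<sigma> k"] by auto
      have [measurable]: "F (\<sigma> k) \<in> borel_measurable (restrict_space lborel ?B)"
        "cutoff \<phi> (real l) \<in> borel_measurable (restrict_space lborel ?B)"
        using F(1) ot_data_imp_usc_cutoff(1)[OF data less_imp_le[OF s(2)]]
        by (auto intro: borel_measurable_restrict_lborel_continuous borel_measurable_restrict_lborel_usc holo_n_imp_continuous_on)
      have "(\<lambda>z. ennreal (cmod (F (\<sigma> k) z) powr p * exp (- cutoff \<phi> (real l) z))) \<in> borel_measurable (restrict_space lborel ?B)"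
        by measurable
      then have "u k \<in> borel_measurable lborel"
        unfolding u_def by (subst (asm) borel_measurable_restrict_space_iff_ennreal) auto
      then show ?thesis unfolding N_def by (rule measurable_restrict_space1)
    qed
    have "(\<integral>\<^sup>+ z. ennreal (cmod (G z) powr p * exp (- cutoff \<phi> (real l) z)) \<partial>N) = (\<integral>\<^sup>+ z. liminf (\<lambda>k. u k z) \<partial>N)"
    proof (rule nn_integral_cong)
      fix z assume "z \<in> space N"
      then have z: "z \<in> ball c r" by (simp add: N_def space_restrict_space)
      \<comment> \<open>Positivity of \<open>p\<close> gives continuity of the power also at zeros
        of \<open>G\<close>.\<close>
      have "(\<lambda>k. ennreal (cmod (F (\<sigma> k) z) powr p * exp (- cutoff \<phi> (real l) z))) \<longlonglongrightarrow> ennreal (cmod (G z) powr p * exp (- cutoff \<phi> (real l) z))"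
        using p by (intro tendsto_intros tendsto_ennrealI tendsto_powr' conv[OF z]) auto
      moreover have "\<forall>\<^sub>F k in sequentially. ennreal (cmod (F (\<sigma> k) z) powr p * exp (- cutoff \<phi> (real l) z)) = u k z"
        using ev[OF z] by eventually_elim (simp add: u_def)
      ultimately have "(\<lambda>k. u k z) \<longlonglongrightarrow> ennreal (cmod (G z) powr p * exp (- cutoff \<phi> (real l) z))"
        by (rule Lim_transform_eventually)
      then show "ennreal (cmod (G z) powr p * exp (- cutoff \<phi> (real l) z)) = liminf (\<lambda>k. u k z)"
        by (simp add: lim_imp_Liminf)
    qed
    also have "\<dots> \<le> liminf (\<lambda>k. \<integral>\<^sup>+ z. u k z \<partial>N)" by (rule nn_integral_liminf[OF meas])
    also have "\<dots> \<le> liminf (\<lambda>k. K + ennreal (inverse (real (Suc (\<sigma> k)))))"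
    proof (rule Liminf_mono)
      show "\<forall>\<^sub>F k in sequentially. (\<integral>\<^sup>+ z. u k z \<partial>N) \<le> K + ennreal (inverse (real (Suc (\<sigma> k))))"
        unfolding eventually_sequentially
      \<comment> \<open>For \<open>k\<close> at least \<open>l\<close> also
        \<open>\<sigma> k\<close> is at least \<open>l\<close>. The truncation at level
        \<open>\<sigma> k\<close> is then the smaller one, and its exponential factor dominates the
        one at level \<open>l\<close>.\<close>
      proof (intro exI[of _ l] allI impI)
        fix k assume "l \<le> k"
        then have lk: "real l \<le> real (\<sigma> k)" using seq_suble[OF \<sigma>, of k] by simp
        have sub: "ball c (s (\<sigma> k)) \<subseteq> ball c r" using s(2)[of "\<sigma> k"] by auto
        have "(\<integral>\<^sup>+ z. u k z \<partial>N) = (\<integral>\<^sup>+ z\<in>ball c r. u k z \<partial>lborel)"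
          by (simp add: N_def nn_integral_restrict_space)
        also have "\<dots> \<le> (\<integral>\<^sup>+ z\<in>ball c (s (\<sigma> k)). ennreal (cmod (F (\<sigma> k) z) powr p * exp (- cutoff \<phi> (real (\<sigma> k)) z)) \<partial>lborel)"
        proof (rule nn_integral_mono)
          fix z
          show "u k z * indicator (ball c r) z \<le> ennreal (cmod (F (\<sigma> k) z) powr p * exp (- cutoff \<phi> (real (\<sigma> k)) z)) * indicator (ball c (s (\<sigma> k))) z"
          proof (cases "z \<in> ball c (s (\<sigma> k))")
            case True
            then have "z \<in> ball c r" using sub by blast
            from cutoff_antimono[of \<phi> z, OF fin[OF this] lk] True \<open>z \<in> ball c r\<close> show ?thesis
              by (auto simp: u_def intro!: ennreal_leI mult_left_mono)
          qed (simp add: u_def)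
        qed
        also have "\<dots> \<le> K + ennreal (inverse (real (Suc (\<sigma> k))))" by (rule F(3))
        finally show "(\<integral>\<^sup>+ z. u k z \<partial>N) \<le> K + ennreal (inverse (real (Suc (\<sigma> k))))" .
      qed
    qed
    also have "\<dots> = K"
    proof -
      from LIMSEQ_subseq_LIMSEQ[OF LIMSEQ_inverse_real_of_nat \<sigma>] have "(\<lambda>k. inverse (real (Suc (\<sigma> k)))) \<longlonglongrightarrow> 0" by (simp add: o_def)
      then have "(\<lambda>k. ennreal \<kappa> + ennreal (inverse (real (Suc (\<sigma> k))))) \<longlonglongrightarrow> ennreal \<kappa> + ennreal 0"
        by (intro tendsto_intros tendsto_ennrealI)
      then show ?thesis using \<kappa>(1) by (simp add: lim_imp_Liminf)
    qed
    finally show ?thesis .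
  qed
  have "(\<integral>\<^sup>+ z\<in>ball c r. ennreal (cmod (G z) powr p) * exp_neg (\<phi> z) \<partial>lborel) = (\<integral>\<^sup>+ z. ennreal (cmod (G z) powr p) * exp_neg (\<phi> z) \<partial>N)"
    by (simp add: N_def nn_integral_restrict_space)
  also have "\<dots> = (\<integral>\<^sup>+ z. (SUP l. ennreal (cmod (G z) powr p) * ennreal (exp (- cutoff \<phi> (real l) z))) \<partial>N)"
  proof (rule nn_integral_cong)
    fix z assume "z \<in> space N"
    then have z: "z \<in> ball c r" by (simp add: N_def space_restrict_space)
    show "ennreal (cmod (G z) powr p) * exp_neg (\<phi> z) = (SUP l. ennreal (cmod (G z) powr p) * ennreal (exp (- cutoff \<phi> (real l) z)))"
      unfolding SUP_exp_cutoff[of \<phi> z, OF fin[OF z], symmetric] by (rule SUP_mult_left_ennreal)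
  qed
  \<comment> \<open>The indicator makes the sequence increasing at every point, including those
    outside the ball, where \<open>\<phi>\<close> may be \<open>\<infinity>\<close> and
    \<open>cutoff\<close> is not monotone in the level.\<close>
  also have "\<dots> = (\<integral>\<^sup>+ z. (SUP l. ennreal (cmod (G z) powr p * exp (- cutoff \<phi> (real l) z)) * indicator (ball c r) z) \<partial>N)"
    by (intro nn_integral_cong) (simp add: N_def space_restrict_space ennreal_mult')
  also have "\<dots> = (SUP l. \<integral>\<^sup>+ z. ennreal (cmod (G z) powr p * exp (- cutoff \<phi> (real l) z)) * indicator (ball c r) z \<partial>N)"
  proof (rule nn_integral_monotone_convergence_SUP)
    show "incseq (\<lambda>l z. ennreal (cmod (G z) powr p * exp (- cutoff \<phi> (real l) z)) * indicator (ball c r) z)"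
      unfolding incseq_def le_fun_def
      by (auto split: split_indicator intro!: ennreal_leI mult_left_mono cutoff_antimono fin)
    have [measurable]: "ball c r \<in> sets N" by (simp add: N_def sets_restrict_space_iff)
    show "(\<lambda>z. ennreal (cmod (G z) powr p * exp (- cutoff \<phi> (real l) z)) * indicator (ball c r) z) \<in> borel_measurable N" for l
      by measurable
  qed
  also have "\<dots> \<le> K"
  proof (rule SUP_least)
    fix l
    have "(\<integral>\<^sup>+ z. ennreal (cmod (G z) powr p * exp (- cutoff \<phi> (real l) z)) * indicator (ball c r) z \<partial>N)
       \<le> (\<integral>\<^sup>+ z. ennreal (cmod (G z) powr p * exp (- cutoff \<phi> (real l) z)) \<partial>N)"
      by (intro nn_integral_mono) (auto split: split_indicator)
    then show "(\<integral>\<^sup>+ z. ennreal (cmod (G z) powr p * exp (- cutoff \<phi> (real l) z)) * indicator (ball c r) z \<partial>N) \<le> K"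
      using step[of l] by (rule order_trans)
  qed
  finally show ?thesis using G Gf unfolding K_def p_def by blast
qed

end
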